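(* Let $N\ge 1$, $0<\theta\le 2$ and $1<p<p_\theta:=1+\theta/N$. Then there exists $\gamma_2>0$ such that, if $\mu$ is a Radon measure in $\mathbf{R}^N$ satisfying $$\sup_{x\in\mathbf{R}^N}\mu(B(x,T^{1/\theta}))\le\gamma_2T^{\frac{N}{\theta}-\frac{1}{p-1}}\quad\text{for some }T>0,$$ then the Cauchy problem $\partial_t u+(-\Delta)^{\theta/2}u=u^p$, $u(0)=\mu$, possesses a solution in $\mathbf{R}^N\times[0,T)$ (in the sense of the context).
   Context: $B(x,r)=\{y\in\mathbf{R}^N:|x-y|<r\}$. Radon measures are nonnegative. $G=G(x,t)$ denotes the fundamental solution of $\partial_t u+(-\Delta)^{\theta/2}u=0$ in $\mathbf{R}^N\times(0,\infty)$, i.e. the positive smooth kernel with $\int_{\mathbf{R}^N}G(x,t)e^{-i\xi\cdot x}\,dx=e^{-t|\xi|^\theta}$ (the Gauss kernel $(4\pi t)^{-N/2}e^{-|x|^2/4t}$ when $\theta=2$). For a Radon measure $\mu$ in $\mathbf{R}^N$ and $0<T\le\infty$, a nonnegative measurable function $u$ in $\mathbf{R}^N\times(0,T)$ is a solution of the Cauchy problem $\partial_t u+(-\Delta)^{\theta/2}u=u^p$, $u(0)=\mu$, in $\mathbf{R}^N\times[0,T)$ if $$\infty>u(x,t)=\int_{\mathbf{R}^N}G(x-y,t)\,d\mu(y)+\int_0^t\int_{\mathbf{R}^N}G(x-y,t-s)u(y,s)^p\,dy\,ds$$ for almost all $x\in\mathbf{R}^N$ and $0<t<T$. *)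

theory Defs
  imports "HOL-Analysis.Analysis"
begin

text \<open>Functions of class C^k and C^infinity on the whole space; \<^term>\<open>frechet_derivative g (at x) v\<close>
  is the derivative of \<^term>\<open>g\<close> at \<^term>\<open>x\<close> in direction \<^term>\<open>v\<close>.\<close>

fun C_k :: "nat \<Rightarrow> ('a::euclidean_space \<Rightarrow> real) \<Rightarrow> bool" where
  "C_k 0 g \<longleftrightarrow> continuous_on UNIV g"
| "C_k (Suc k) g \<longleftrightarrow>
     g differentiable_on UNIV \<and> (\<forall>v. C_k k (\<lambda>x. frechet_derivative g (at x) v))"

definition smooth :: "('a::euclidean_space \<Rightarrow> real) \<Rightarrow> bool" where
  "smooth g \<longleftrightarrow> (\<forall>k. C_k k g)"

text \<open>The fundamental solution of the fractional heat equation with generator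
  \<open>-(-\<Delta>)^(\<theta>/2)\<close>, to be used for \<open>0 < \<theta> \<le> 2\<close> and \<open>t > 0\<close>. A continuous integrable function is
  determined by its Fourier transform, so the description of \<open>G(\<cdot>,t)\<close> is unique for each single
  \<open>t\<close>. The argument order is exponent, point, time.\<close>

definition frac_heat_kernel :: "real \<Rightarrow> 'a::euclidean_space \<Rightarrow> real \<Rightarrow> real" where
  "frac_heat_kernel \<theta> x t =
     (THE g. smooth g \<and> (\<forall>y. g y > 0) \<and> integrable lborel g \<and>
        (\<forall>\<xi>. (LINT y|lborel. complex_of_real (g y) * exp (- (\<i> * complex_of_real (\<xi> \<bullet> y))))
              = complex_of_real (exp (- t * norm \<xi> powr \<theta>)))) x"

text \<open>A locally finite Borel measure on a Euclidean space is automatically regular, so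
  regularity is not listed.\<close>

definition radon_measure :: "'a::euclidean_space measure \<Rightarrow> bool" where
  "radon_measure \<mu> \<longleftrightarrow> sets \<mu> = sets borel \<and> (\<forall>K. compact K \<longrightarrow> emeasure \<mu> K < \<infinity>)"

text \<open>Real powers on \<open>[0,\<infinity>]\<close>, for positive exponents (so that \<open>\<infinity>\<close> is sent to \<open>\<infinity>\<close>).\<close>

definition ennreal_powr :: "ennreal \<Rightarrow> real \<Rightarrow> ennreal" where
  "ennreal_powr a p = (if a = \<infinity> then \<infinity> else ennreal (enn2real a powr p))"

text \<open>Solutions of \<open>\<partial>\<^sub>t u + (-\<Delta>)^(\<theta>/2) u = u^p\<close>, \<open>u(0) = \<mu>\<close>, in \<open>R^N \<times> [0,T)\<close> with
  \<open>0 < T \<le> \<infinity>\<close>. A solution is a Lebesgue measurable function with values in \<open>[0,\<infinity>]\<close>; for every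
  \<open>t\<close> in \<open>(0,T)\<close> the integral equation holds, with a finite value, for almost all \<open>x\<close>. All
  integrals have nonnegative integrands and are taken in \<open>[0,\<infinity>]\<close>.\<close>

definition is_solution ::
  "real \<Rightarrow> real \<Rightarrow> 'a::euclidean_space measure \<Rightarrow> ereal \<Rightarrow> ('a \<Rightarrow> real \<Rightarrow> ennreal) \<Rightarrow> bool" where
  "is_solution \<theta> p \<mu> T u \<longleftrightarrow>
     (\<lambda>(x, t). u x t) \<in> borel_measurable (lebesgue_on (UNIV \<times> {t. 0 < t \<and> ereal t < T})) \<and>
     (\<forall>t. 0 < t \<and> ereal t < T \<longrightarrow>
        (AE x in lborel.
           u x t < \<infinity> \<and>
           u x t =
             (\<integral>\<^sup>+ y. ennreal (frac_heat_kernel \<theta> (x - y) t) \<partial>\<mu>) +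
             (\<integral>\<^sup>+ s\<in>{0<..<t}. (\<integral>\<^sup>+ y. ennreal (frac_heat_kernel \<theta> (x - y) (t - s)) *
                                     ennreal_powr (u y s) p \<partial>lborel) \<partial>lborel)))"

end

theory Submission
  imports Defs "HOL-Probability.Probability" "HOL-Real_Asymp.Real_Asymp"
begin

text \<open>
  Let \<open>H(x,t)\<close> be the heat evolution of \<open>\<mu>\<close>. If \<open>2 H\<close> is a supersolution of the integral equation, then
  Picard iteration from \<open>0\<close> increases to a solution below \<open>2 H\<close>. Since \<open>(2 H)^p \<le> 2^p \<parallel>H(s)\<parallel>^(p-1) H\<close>, the
  semigroup property bounds the Duhamel term of \<open>2 H\<close> by \<open>H\<close> times the integral of
  \<open>2^p \<parallel>H(s)\<parallel>^(p-1)\<close>. The bound \<open>\<parallel>H(s)\<parallel> \<le> C s^(-N/\<theta>) sup \<mu>(B(x, s^(1/\<theta>)))\<close> makes that integral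
  convergent because \<open>(p-1) N/\<theta> < 1\<close>, and at most \<open>1\<close> if \<open>\<gamma>\<^sub>2\<close> is small.

  The kernel is defined by the inverse Fourier integral of \<open>exp (-t |\<xi>|^\<theta>)\<close>; uniqueness, the Fourier transform
  and the semigroup property follow from Fourier inversion. For positivity and radial monotonicity, put
  \<open>\<alpha> = \<theta>/2\<close>: the power series of \<open>1 - (1 - q)^\<alpha>\<close> has nonnegative coefficients, and
  \<open>(1 - (1 - exp (-s r))^\<alpha>)^n\<close> with \<open>s = (t/n)^(1/\<alpha>)\<close> tends to \<open>exp (-t r^\<alpha>)\<close>, so with \<open>r = |\<xi>|\<^sup>2\<close> the
  symbol is a limit of nonnegative combinations of Gaussians.
\<close>

section \<open>Gaussian integrals and Fourier inversion\<close>

text \<open>For general \<theta> the kernel has no elementary closed form, so its positivity has to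
  survive a limit; hence the use of inequalities that are closed under pointwise limits, in place of
  an explicit mixing measure. Positivity comes before integrability, and both come before inversion:
  the inverse transform of the symbol is not integrable for evident reasons, but being nonnegative
  it has a mass that Gaussian damping controls. Radial monotonicity has a separate use: it compares
  the kernel with its own averages, so the smoothing bound follows from Fubini without covering the
  space by balls. Put q = (p-1) N/\<theta>; then p < 1 + \<theta>/N says exactly that q < 1. The
  hypothesis gives H(x,s) \<le> M s^(-N/\<theta>) with M a fixed multiple of T^(N/\<theta> -
  1/(p-1)). Then M^(p-1) is a multiple of T^(q-1), while s^(-q) has integral T^(1-q)/(1-q) over
  (0,T). The powers of T cancel, which is why one smallness constant serves all T.\<close>

lemma nn_integral_lborel_affine:
  fixes f :: "'a::euclidean_space \<Rightarrow> ennreal"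
  assumes c: "c \<noteq> 0" and [measurable]: "f \<in> borel_measurable borel"
  shows "(\<integral>\<^sup>+x. f x \<partial>lborel) = ennreal (\<bar>c\<bar> ^ DIM('a)) * (\<integral>\<^sup>+x. f (t + c *\<^sub>R x) \<partial>lborel)"
  by (subst lborel_affine[OF c, of t]) (simp add: nn_integral_density nn_integral_distr nn_integral_cmult)

lemma integrable_lborel_affine_iff:
  fixes f :: "'a::euclidean_space \<Rightarrow> 'b::{banach, second_countable_topology}"
  assumes c: "c \<noteq> 0" and [measurable]: "f \<in> borel_measurable borel"
  shows "integrable lborel (\<lambda>x. f (t + c *\<^sub>R x)) \<longleftrightarrow> integrable lborel f"
proof -
  have "integrable lborel g" if "integrable lborel (\<lambda>x. \<bar>c\<bar> ^ DIM('a) *\<^sub>R g x)" for g :: "'a \<Rightarrow> 'b"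
  proof -
    have "integrable lborel (\<lambda>x. inverse (\<bar>c\<bar> ^ DIM('a)) *\<^sub>R (\<bar>c\<bar> ^ DIM('a) *\<^sub>R g x))"
      using that by (rule integrable_scaleR_right)
    then show ?thesis using c by simp
  qed
  from this[of "\<lambda>x. f (t + c *\<^sub>R x)"]
  have "integrable lborel (\<lambda>x. f (t + c *\<^sub>R x)) \<longleftrightarrow> integrable lborel (\<lambda>x. \<bar>c\<bar> ^ DIM('a) *\<^sub>R f (t + c *\<^sub>R x))"
    using integrable_scaleR_right[of "\<bar>c\<bar> ^ DIM('a)" lborel "\<lambda>x. f (t + c *\<^sub>R x)"] by blast
  also have "\<dots> \<longleftrightarrow> integrable (distr lborel borel (\<lambda>x. t + c *\<^sub>R x)) (\<lambda>x. \<bar>c\<bar> ^ DIM('a) *\<^sub>R f x)"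
    by (subst integrable_distr_eq) simp_all
  also have "\<dots> \<longleftrightarrow> integrable (density (distr lborel borel (\<lambda>x. t + c *\<^sub>R x)) (\<lambda>_. ennreal (\<bar>c\<bar> ^ DIM('a)))) f"
    by (subst integrable_density) simp_all
  finally show ?thesis
    by (simp only: lborel_affine[OF c, of t, symmetric])
qed

lemma integral_lborel_affine:
  fixes f :: "'a::euclidean_space \<Rightarrow> 'b::{banach, second_countable_topology}"
  assumes c: "c \<noteq> 0" and [measurable]: "f \<in> borel_measurable borel"
  shows "(LINT x|lborel. f x) = \<bar>c\<bar> ^ DIM('a) *\<^sub>R (LINT x|lborel. f (t + c *\<^sub>R x))"
  by (subst lborel_affine[OF c, of t]) (simp add: integral_density integral_distr)

text \<open>Fubini in coordinates: \<open>lborel\<close> is the image of a product of real Lebesgue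
  measures under basis expansion. It reduces the Gaussian transform and the majorant 1/(1+|x|^2)^N
  to one dimension.\<close>

lemma has_bochner_integral_lborel_prod:
  fixes f :: "'a::euclidean_space \<Rightarrow> real \<Rightarrow> 'b::{real_normed_field, banach, second_countable_topology}"
  assumes f: "\<And>b. b \<in> Basis \<Longrightarrow> has_bochner_integral lborel (f b) (I b)"
  shows "has_bochner_integral lborel (\<lambda>x. \<Prod>b\<in>Basis. f b (x \<bullet> b)) (\<Prod>b\<in>Basis. I b)"
proof -
  interpret product_sigma_finite "\<lambda>_::'a. lborel :: real measure" ..
  have [measurable]: "f b \<in> borel_measurable borel" if "b \<in> Basis" for b
    using f[OF that] by (auto simp: has_bochner_integral_iff)
  let ?P = "\<Pi>\<^sub>M b\<in>(Basis::'a set). (lborel::real measure)"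
  have eq: "(\<Prod>b\<in>Basis. f b ((\<Sum>i\<in>Basis. x i *\<^sub>R i) \<bullet> b)) = (\<Prod>b\<in>Basis. f b (x b))" for x :: "'a \<Rightarrow> real"
    by (intro prod.cong refl) (simp add: inner_sum_left inner_Basis if_distrib[of "\<lambda>t. _ * t"] sum.delta cong: if_cong)
  have "has_bochner_integral ?P (\<lambda>x. \<Prod>b\<in>Basis. f b (x b)) (\<Prod>b\<in>Basis. I b)"
    using f unfolding has_bochner_integral_iff
    by (auto intro!: product_integrable_prod simp: product_integral_prod)
  then have "has_bochner_integral ?P (\<lambda>x. \<Prod>b\<in>Basis. f b ((\<Sum>i\<in>Basis. x i *\<^sub>R i) \<bullet> b)) (\<Prod>b\<in>Basis. I b)"
    by (simp only: eq)
  then have "has_bochner_integral (distr ?P borel (\<lambda>f. \<Sum>b\<in>Basis. f b *\<^sub>R b))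
      (\<lambda>x. \<Prod>b\<in>Basis. f b (x \<bullet> b)) (\<Prod>b\<in>Basis. I b)"
    by (subst has_bochner_integral_iff, subst integrable_distr_eq, measurable, subst integral_distr, measurable)
      (simp add: has_bochner_integral_iff)
  then show ?thesis by (simp only: lborel_eq[symmetric])
qed

text \<open>Replacing u by u/c with c = sqrt (2 s) turns the integrand into the standard normal
  density times a character, so the value comes from the characteristic function of the normal law
  at x/c.\<close>

lemma has_bochner_integral_gauss_cis_real:
  fixes s x :: real
  assumes s: "s > 0"
  shows "has_bochner_integral lborel (\<lambda>u. cis (u * x) * complex_of_real (exp (- s * u\<^sup>2)))
           (complex_of_real (sqrt (pi / s) * exp (- x\<^sup>2 / (4 * s))))"
proof -
  define c where "c = sqrt (2 * s)"
  have c: "c > 0" "c\<^sup>2 = 2 * s" using s by (auto simp: c_def)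
  let ?f = "\<lambda>u. cis (u * x) * complex_of_real (exp (- s * u\<^sup>2))"
  have [measurable]: "cis \<in> borel_measurable borel"
    by (intro borel_measurable_continuous_onI continuous_intros)
  have int: "integrable lborel (\<lambda>u. complex_of_real (std_normal_density u) * cis (u * (x / c)))"
    by (rule Bochner_Integration.integrable_bound[OF integrable_normal_density[of 1 0]])
      (auto simp: norm_mult)
  have "char std_normal_distribution (x / c) = (LINT u|lborel. complex_of_real (std_normal_density u) * cis (u * (x / c)))"
    by (simp add: char_def integral_density scaleR_conv_of_real cis_conv_exp mult_ac)
  then have val: "(LINT u|lborel. complex_of_real (std_normal_density u) * cis (u * (x / c)))
      = complex_of_real (exp (- (x / c)\<^sup>2 / 2))"
    by (simp add: char_std_normal_distribution)
  have eq: "?f (0 + (1 / c) *\<^sub>R u) = complex_of_real (sqrt (2 * pi)) * (complex_of_real (std_normal_density u) * cis (u * (x / c)))" for u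
  proof -
    have "s * (u / c)\<^sup>2 = u\<^sup>2 / 2" using c s by (simp add: power_divide)
    then have "exp (- s * (u / c)\<^sup>2) = sqrt (2 * pi) * std_normal_density u"
      by (simp add: normal_density_def)
    then show ?thesis by simp
  qed
  have c1: "1 / c \<noteq> 0" using c by simp
  have [measurable]: "?f \<in> borel_measurable borel" by measurable
  have "integrable lborel (\<lambda>u. ?f (0 + (1 / c) *\<^sub>R u))"
    unfolding eq using int by simp
  then have 1: "integrable lborel ?f"
    using integrable_lborel_affine_iff[OF c1 \<open>?f \<in> _\<close>, of 0] by (simp only:)
  have "(LINT u|lborel. ?f u) = complex_of_real ((1 / c) * sqrt (2 * pi) * exp (- (x / c)\<^sup>2 / 2))"
    unfolding integral_lborel_affine[OF c1 \<open>?f \<in> _\<close>, of 0] eq integral_mult_right_zero val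
    using c by (simp add: scaleR_conv_of_real)
  also have "(1 / c) * sqrt (2 * pi) * exp (- (x / c)\<^sup>2 / 2) = sqrt (pi / s) * exp (- x\<^sup>2 / (4 * s))"
    using s by (simp add: c_def power_divide power_mult_distrib real_sqrt_mult real_sqrt_divide)
  finally show ?thesis using 1 by (simp add: has_bochner_integral_iff)
qed

lemma has_bochner_integral_gauss_cis:
  fixes x :: "'a::euclidean_space"
  assumes s: "s > 0"
  shows "has_bochner_integral lborel (\<lambda>u::'a. cis (u \<bullet> x) * complex_of_real (exp (- s * (norm u)\<^sup>2)))
           (complex_of_real (sqrt (pi / s) ^ DIM('a) * exp (- (norm x)\<^sup>2 / (4 * s))))"
proof -
  have n: "(norm y)\<^sup>2 = (\<Sum>b\<in>Basis. (y \<bullet> b)\<^sup>2)" for y :: 'a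
    by (subst norm_eq_sqrt_inner, subst euclidean_inner) (simp add: sum_nonneg power2_eq_square)
  have cis_sum: "cis (\<Sum>b\<in>A. g b) = (\<Prod>b\<in>A. cis (g b))" if "finite A" for g and A :: "'a set"
    using that by (induction A) (auto simp flip: cis_mult)
  have "has_bochner_integral lborel
     (\<lambda>u::'a. \<Prod>b\<in>Basis. cis ((u \<bullet> b) * (x \<bullet> b)) * complex_of_real (exp (- s * (u \<bullet> b)\<^sup>2)))
     (\<Prod>b\<in>(Basis :: 'a set). complex_of_real (sqrt (pi / s) * exp (- (x \<bullet> b)\<^sup>2 / (4 * s))))"
    by (intro has_bochner_integral_lborel_prod has_bochner_integral_gauss_cis_real s)
  moreover have "(\<Prod>b\<in>Basis. cis ((u \<bullet> b) * (x \<bullet> b)) * complex_of_real (exp (- s * (u \<bullet> b)\<^sup>2)))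
      = cis (u \<bullet> x) * complex_of_real (exp (- s * (norm u)\<^sup>2))" for u :: 'a
    unfolding euclidean_inner[of u x]
    by (simp add: prod.distrib cis_sum n sum_distrib_left sum_negf flip: of_real_prod exp_sum)
  moreover have "(\<Prod>b\<in>(Basis :: 'a set). complex_of_real (sqrt (pi / s) * exp (- (x \<bullet> b)\<^sup>2 / (4 * s))))
      = complex_of_real (sqrt (pi / s) ^ DIM('a) * exp (- (norm x)\<^sup>2 / (4 * s)))"
    by (simp add: prod.distrib n sum_divide_distrib sum_negf flip: of_real_prod exp_sum)
  ultimately show ?thesis by simp
qed

lemma borel_measurable_cis [measurable]: "cis \<in> borel_measurable borel"
  by (intro borel_measurable_continuous_onI continuous_intros)

section \<open>Multiplication formula and Fourier inversion\<close>

lemma integrable_tensor: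
  fixes f g :: "'a::euclidean_space \<Rightarrow> complex"
  assumes f: "integrable lborel f" and g: "integrable lborel g"
    and K [measurable]: "(\<lambda>(x, y). K x y) \<in> borel_measurable (borel \<Otimes>\<^sub>M borel)"
    and K1: "\<And>x y. norm (K x y) \<le> 1"
  shows "integrable (lborel \<Otimes>\<^sub>M lborel) (\<lambda>(x, y). f x * (g y * K x y))"
proof -
  have [measurable]: "f \<in> borel_measurable borel" "g \<in> borel_measurable borel"
    using f g by (auto dest: borel_measurable_integrable)
  have "integrable (lborel \<Otimes>\<^sub>M lborel) (\<lambda>(x, y). f x * g y)"
    by (intro lborel_pair.Fubini_integrable)
      (use f g in \<open>auto simp: norm_mult intro!: integrable_mult_right integrable_norm\<close>)
  then show ?thesis
  proof (rule Bochner_Integration.integrable_bound)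
    show "AE z in lborel \<Otimes>\<^sub>M lborel. norm (case z of (x, y) \<Rightarrow> f x * (g y * K x y)) \<le> norm (case z of (x, y) \<Rightarrow> f x * g y)"
      using K1 by (auto simp: norm_mult intro!: AE_I2 mult_left_mono mult_left_le)
  qed measurable
qed

text \<open>For a character K this is the multiplication formula, which moves the Fourier transform
  from one factor to the other. It serves both the inversion theorem and the semigroup
  property.\<close>

lemma integral_tensor_swap:
  fixes f g :: "'a::euclidean_space \<Rightarrow> complex"
  assumes f: "integrable lborel f" and g: "integrable lborel g"
    and K: "(\<lambda>(x, y). K x y) \<in> borel_measurable (borel \<Otimes>\<^sub>M borel)"
    and K1: "\<And>x y. norm (K x y) \<le> 1"
  shows "(LINT x|lborel. f x * (LINT y|lborel. g y * K x y)) = (LINT y|lborel. g y * (LINT x|lborel. f x * K x y))"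
proof -
  have "(LINT x|lborel. f x * (LINT y|lborel. g y * K x y)) = (LINT x|lborel. LINT y|lborel. f x * (g y * K x y))"
    by (simp flip: integral_mult_right_zero)
  also have "\<dots> = (LINT y|lborel. LINT x|lborel. f x * (g y * K x y))"
    using lborel_pair.Fubini_integral[OF integrable_tensor[OF assms]] by simp
  also have "\<dots> = (LINT y|lborel. g y * (LINT x|lborel. f x * K x y))"
    by (simp add: mult_ac flip: integral_mult_right_zero)
  finally show ?thesis .
qed

text \<open>Sign and normalisation agree with \<open>frac_heat_kernel\<close>, so the factor (2
  pi)^N shows up only on inversion.\<close>

definition fourier :: "('a::euclidean_space \<Rightarrow> complex) \<Rightarrow> 'a \<Rightarrow> complex" where
  "fourier f \<xi> = (LINT y|lborel. f y * cis (- (\<xi> \<bullet> y)))"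

text \<open>The damping makes the inversion integral converge even if \<open>fourier f\<close> is
  not integrable; the multiplication formula then evaluates it as a Gaussian smoothing of f.\<close>

lemma fourier_gauss_pairing:
  fixes f :: "'a::euclidean_space \<Rightarrow> complex"
  assumes f: "integrable lborel f" and s: "s > 0"
  shows "(LINT \<xi>|lborel. cis (\<xi> \<bullet> x) * complex_of_real (exp (- s * (norm \<xi>)\<^sup>2)) * fourier f \<xi>)
    = (LINT y|lborel. f y * complex_of_real (sqrt (pi / s) ^ DIM('a) * exp (- (norm (x - y))\<^sup>2 / (4 * s))))"
proof -
  have "(LINT \<xi>|lborel. cis (\<xi> \<bullet> x) * complex_of_real (exp (- s * (norm \<xi>)\<^sup>2)) * fourier f \<xi>)
    = (LINT y|lborel. f y * (LINT \<xi>|lborel. cis (\<xi> \<bullet> x) * complex_of_real (exp (- s * (norm \<xi>)\<^sup>2)) * cis (- (\<xi> \<bullet> y))))"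
    unfolding fourier_def
    by (intro integral_tensor_swap f) (use has_bochner_integral_gauss_cis[OF s, of x] in \<open>auto simp: has_bochner_integral_iff\<close>)
  also have "(\<lambda>y. LINT \<xi>|lborel. cis (\<xi> \<bullet> x) * complex_of_real (exp (- s * (norm \<xi>)\<^sup>2)) * cis (- (\<xi> \<bullet> y)))
      = (\<lambda>y. complex_of_real (sqrt (pi / s) ^ DIM('a) * exp (- (norm (x - y))\<^sup>2 / (4 * s))))"
  proof
    fix y
    have "cis (\<xi> \<bullet> x) * complex_of_real (exp (- s * (norm \<xi>)\<^sup>2)) * cis (- (\<xi> \<bullet> y))
      = cis (\<xi> \<bullet> (x - y)) * complex_of_real (exp (- s * (norm \<xi>)\<^sup>2))" for \<xi>
      by (simp add: inner_diff_right cis_mult mult.commute mult.left_commute)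
    then show "(LINT \<xi>|lborel. cis (\<xi> \<bullet> x) * complex_of_real (exp (- s * (norm \<xi>)\<^sup>2)) * cis (- (\<xi> \<bullet> y)))
      = complex_of_real (sqrt (pi / s) ^ DIM('a) * exp (- (norm (x - y))\<^sup>2 / (4 * s)))"
      using has_bochner_integral_gauss_cis[OF s, of "x - y"] by (simp only: has_bochner_integral_iff)
  qed
  finally show ?thesis .
qed

lemma has_bochner_integral_gauss:
  assumes s: "s > 0"
  shows "has_bochner_integral lborel (\<lambda>u::'a::euclidean_space. exp (- s * (norm u)\<^sup>2)) (sqrt (pi / s) ^ DIM('a))"
proof -
  have "has_bochner_integral lborel (\<lambda>u::'a. complex_of_real (exp (- s * (norm u)\<^sup>2))) (complex_of_real (sqrt (pi / s) ^ DIM('a)))"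
    using has_bochner_integral_gauss_cis[OF s, of "0::'a"] by simp
  then show ?thesis
    unfolding has_bochner_integral_iff integral_complex_of_real of_real_eq_iff complex_of_real_integrable_eq .
qed

lemma gauss_approximate_identity:
  fixes f :: "'a::euclidean_space \<Rightarrow> complex"
  assumes cont: "continuous_on UNIV f" and f: "integrable lborel f"
  shows "(\<lambda>n. LINT y|lborel. f y * complex_of_real ((real (Suc n) / sqrt pi) ^ DIM('a) * exp (- (real (Suc n))\<^sup>2 * (norm (x - y))\<^sup>2)))
           \<longlonglongrightarrow> f x"
proof -
  define k where "k n y = complex_of_real ((real (Suc n) / sqrt pi) ^ DIM('a) * exp (- (real (Suc n))\<^sup>2 * (norm (x - y))\<^sup>2))" for n y
  define f1 where "f1 y = indicator (cball x 1) y *\<^sub>R f y" for y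
  define f2 where "f2 y = indicator (- cball x 1) y *\<^sub>R f y" for y
  have [measurable]: "f \<in> borel_measurable borel" "\<And>n. k n \<in> borel_measurable borel"
    using cont by (auto simp: k_def intro!: borel_measurable_continuous_onI continuous_intros)
  have [measurable]: "cball x 1 \<in> sets borel" "- cball x 1 \<in> sets borel" by (auto intro: borel_comp)
  have [measurable]: "f1 \<in> borel_measurable borel" "f2 \<in> borel_measurable borel"
    unfolding f1_def f2_def by measurable
  obtain B where B: "\<And>y. y \<in> cball x 1 \<Longrightarrow> norm (f y) \<le> B"
    using compact_imp_bounded[OF compact_continuous_image[OF continuous_on_subset[OF cont] compact_cball, of x 1]]
    unfolding bounded_iff by (metis imageI subset_UNIV)
  have B0: "0 \<le> B" using B[of x] norm_ge_zero[of "f x"] by (simp del: norm_ge_zero)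
  have f1B: "norm (f1 y) \<le> B" for y using B B0 by (auto simp: f1_def indicator_def)
  have k_le: "norm (k n y) \<le> (real (Suc n) / sqrt pi) ^ DIM('a)" for n y
    unfolding k_def norm_of_real abs_mult by (auto simp: mult_le_cancel_left1 intro!: mult_left_le)
  have int: "integrable lborel (\<lambda>y. g y * k n y)" if "integrable lborel g" for g n
  proof (rule Bochner_Integration.integrable_bound)
    show "integrable lborel (\<lambda>y. complex_of_real ((real (Suc n) / sqrt pi) ^ DIM('a)) * g y)" using that by simp
    show "AE y in lborel. norm (g y * k n y) \<le> norm (complex_of_real ((real (Suc n) / sqrt pi) ^ DIM('a)) * g y)"
      unfolding norm_mult norm_of_real
      using mult_right_mono[OF k_le norm_ge_zero[of "g _"]] by (simp add: mult.commute)
  qed (use that in measurable)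
  have if1: "integrable lborel f1" and if2: "integrable lborel f2"
    unfolding f1_def f2_def using f by (auto intro!: integrable_mult_indicator)
  have "(\<lambda>n. LINT y|lborel. f1 y * k n y) \<longlonglongrightarrow> f x"
  proof -
    have m: "real (Suc n) \<noteq> 0" for n by simp
    \<comment> \<open>The substitution y = x + z/(n+1) freezes the Gaussian and moves the dependence
      on n into the argument of \<open>f1\<close>.\<close>
    have eq: "(LINT y|lborel. f1 y * k n y) =
        complex_of_real ((1 / sqrt pi) ^ DIM('a)) * (LINT z|lborel. f1 (x + (1 / real (Suc n)) *\<^sub>R z) * complex_of_real (exp (- (norm z)\<^sup>2)))" for n
    proof -
      define m where "m = real (Suc n)"
      have m0: "m > 0" by (simp add: m_def)
      have keq: "k n (x + (1 / m) *\<^sub>R z) = complex_of_real ((m / sqrt pi) ^ DIM('a) * exp (- (norm z)\<^sup>2))" for z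
        unfolding k_def m_def[symmetric] using m0 by (simp add: power_mult_distrib power_divide)
      have "(LINT y|lborel. f1 y * k n y) = \<bar>1 / m\<bar> ^ DIM('a) *\<^sub>R (LINT z|lborel. f1 (x + (1 / m) *\<^sub>R z) * k n (x + (1 / m) *\<^sub>R z))"
        by (rule integral_lborel_affine) (use m0 in auto)
      also have "\<dots> = complex_of_real ((1 / m) ^ DIM('a) * (m / sqrt pi) ^ DIM('a)) * (LINT z|lborel. f1 (x + (1 / m) *\<^sub>R z) * complex_of_real (exp (- (norm z)\<^sup>2)))"
        unfolding keq using m0 by (simp add: scaleR_conv_of_real mult_ac flip: integral_mult_right_zero)
      also have "(1 / m) ^ DIM('a) * (m / sqrt pi) ^ DIM('a) = (1 / sqrt pi) ^ DIM('a)"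
        using m0 by (simp add: power_divide)
      finally show ?thesis unfolding m_def .
    qed
    have G: "has_bochner_integral lborel (\<lambda>u::'a. exp (- (norm u)\<^sup>2)) (sqrt pi ^ DIM('a))"
      using has_bochner_integral_gauss[of 1, where 'a='a] by simp
    have "(\<lambda>n. LINT z|lborel. f1 (x + (1 / real (Suc n)) *\<^sub>R z) * complex_of_real (exp (- (norm z)\<^sup>2)))
      \<longlonglongrightarrow> (LINT z|lborel. f x * complex_of_real (exp (- (norm (z::'a))\<^sup>2)))"
    proof (rule integral_dominated_convergence)
      show "integrable lborel (\<lambda>z::'a. B * exp (- (norm z)\<^sup>2))"
        using G by (auto simp: has_bochner_integral_iff)
      show "AE z in lborel. (\<lambda>n. f1 (x + (1 / real (Suc n)) *\<^sub>R z) * complex_of_real (exp (- (norm z)\<^sup>2)))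
          \<longlonglongrightarrow> f x * complex_of_real (exp (- (norm z)\<^sup>2))"
      proof (intro AE_I2 tendsto_mult tendsto_const)
        fix z :: 'a
        have "(\<lambda>n. 1 / real (Suc n)) \<longlonglongrightarrow> 0" by real_asymp
        then have lim: "(\<lambda>n. x + (1 / real (Suc n)) *\<^sub>R z) \<longlonglongrightarrow> x + 0 *\<^sub>R z" by (intro tendsto_intros)
        have "isCont f x" using cont by (simp add: continuous_on_eq_continuous_at)
        then have "(\<lambda>n. f (x + (1 / real (Suc n)) *\<^sub>R z)) \<longlonglongrightarrow> f x"
          using lim by (intro isCont_tendsto_compose[of x f]) simp_all
        moreover have "eventually (\<lambda>n. x + (1 / real (Suc n)) *\<^sub>R z \<in> ball x 1) sequentially"
          by (rule topological_tendstoD[OF lim]) auto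
        then have "eventually (\<lambda>n. f1 (x + (1 / real (Suc n)) *\<^sub>R z) = f (x + (1 / real (Suc n)) *\<^sub>R z)) sequentially"
          by eventually_elim (auto simp: f1_def indicator_def)
        ultimately show "(\<lambda>n. f1 (x + (1 / real (Suc n)) *\<^sub>R z)) \<longlonglongrightarrow> f x"
          by (simp add: filterlim_cong)
      qed
      show "AE z in lborel. norm (f1 (x + (1 / real (Suc n)) *\<^sub>R z) * complex_of_real (exp (- (norm z)\<^sup>2)))
           \<le> B * exp (- (norm z)\<^sup>2)" for n
        using f1B by (auto simp: norm_mult intro!: AE_I2 mult_right_mono)
    qed measurable
    also have "(LINT z|lborel. f x * complex_of_real (exp (- (norm (z::'a))\<^sup>2))) = f x * complex_of_real (sqrt pi ^ DIM('a))"
      using G by (simp add: has_bochner_integral_iff)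
    finally have "(\<lambda>n. LINT y|lborel. f1 y * k n y) \<longlonglongrightarrow> complex_of_real ((1 / sqrt pi) ^ DIM('a)) * (f x * complex_of_real (sqrt pi ^ DIM('a)))"
      unfolding eq by (intro tendsto_mult tendsto_const)
    also have "complex_of_real ((1 / sqrt pi) ^ DIM('a)) * (f x * complex_of_real (sqrt pi ^ DIM('a))) = f x"
      by (simp add: power_divide)
    finally show ?thesis .
  qed
  moreover have "(\<lambda>n. LINT y|lborel. f2 y * k n y) \<longlonglongrightarrow> 0"
  proof (rule Lim_null_comparison)
    show "\<forall>\<^sub>F n in sequentially. norm (LINT y|lborel. f2 y * k n y) \<le>
       (1 / sqrt pi) ^ DIM('a) * (real (Suc n) ^ DIM('a) / exp (real (Suc n))) * (LINT y|lborel. norm (f2 y))"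
    proof (intro always_eventually allI)
      fix n
      define m where "m = real (Suc n)"
      have m1: "m \<ge> 1" by (simp add: m_def)
      have "norm (LINT y|lborel. f2 y * k n y) \<le> (LINT y|lborel. norm (f2 y * k n y))"
        by (rule integral_norm_bound)
      also have "\<dots> \<le> (LINT y|lborel. (m / sqrt pi) ^ DIM('a) * exp (- m) * norm (f2 y))"
      proof (intro integral_mono integrable_norm int if2 integrable_mult_right)
        fix y
        show "norm (f2 y * k n y) \<le> (m / sqrt pi) ^ DIM('a) * exp (- m) * norm (f2 y)"
        proof (cases "y \<in> cball x 1")
          case False
          then have "norm (x - y) \<ge> 1" by (simp add: dist_norm)
          then have "1 \<le> (norm (x - y))\<^sup>2" by simp
          \<comment> \<open>Trading m^2 |x-y|^2 for m leaves a bound of order m^N exp (-m), which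
            tends to 0.\<close>
          then have "m * 1 \<le> m\<^sup>2 * (norm (x - y))\<^sup>2"
            using m1 by (intro mult_mono) (auto simp: power2_eq_square)
          then have "norm (k n y) \<le> (m / sqrt pi) ^ DIM('a) * exp (- m)"
            unfolding k_def m_def[symmetric] norm_of_real using m1
            by (simp add: abs_mult mult_left_mono)
          from mult_left_mono[OF this norm_ge_zero[of "f2 y"]] show ?thesis
            unfolding norm_mult by (simp only: mult.commute)
        qed (auto simp: f2_def)
      qed
      finally show "norm (LINT y|lborel. f2 y * k n y) \<le>
       (1 / sqrt pi) ^ DIM('a) * (real (Suc n) ^ DIM('a) / exp (real (Suc n))) * (LINT y|lborel. norm (f2 y))"
        unfolding m_def[symmetric] by (simp add: power_divide exp_minus divide_simps)
    qed
    have "((\<lambda>x. x ^ DIM('a) / exp x) \<longlongrightarrow> (0::real)) at_top" by (rule tendsto_power_div_exp_0)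
    moreover have "filterlim (\<lambda>n. real (Suc n)) at_top sequentially" by real_asymp
    ultimately have "(\<lambda>n. real (Suc n) ^ DIM('a) / exp (real (Suc n))) \<longlonglongrightarrow> 0"
      by (rule filterlim_compose)
    then show "(\<lambda>n. (1 / sqrt pi) ^ DIM('a) * (real (Suc n) ^ DIM('a) / exp (real (Suc n))) * (LINT y|lborel. norm (f2 y))) \<longlonglongrightarrow> 0"
      by (intro tendsto_mult_left_zero tendsto_mult_right_zero)
  qed
  ultimately have "(\<lambda>n. (LINT y|lborel. f1 y * k n y) + (LINT y|lborel. f2 y * k n y)) \<longlonglongrightarrow> f x + 0"
    by (rule tendsto_add)
  moreover have "(LINT y|lborel. f1 y * k n y) + (LINT y|lborel. f2 y * k n y) = (LINT y|lborel. f y * k n y)" for n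
    by (subst Bochner_Integration.integral_add[symmetric, OF int[OF if1] int[OF if2]])
      (auto intro!: Bochner_Integration.integral_cong simp: f1_def f2_def indicator_def)
  ultimately show ?thesis by (simp add: k_def)
qed

text \<open>The damped inversion integral has two limits: dominated convergence with majorant
  |\<open>fourier f\<close>| gives the left side, the approximate identity gives the right
  side.\<close>

lemma fourier_inversion:
  fixes f :: "'a::euclidean_space \<Rightarrow> complex"
  assumes cont: "continuous_on UNIV f" and f: "integrable lborel f" and F: "integrable lborel (fourier f)"
  shows "(LINT \<xi>|lborel. fourier f \<xi> * cis (\<xi> \<bullet> x)) = (2 * pi) ^ DIM('a) * f x"
proof (rule LIMSEQ_unique)
  \<comment> \<open>Chosen so that exp (-|x-y|^2/(4 s)) becomes the kernel exp (-(n+1)^2 |x-y|^2) of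
    the approximate identity.\<close>
  define s where "s n = 1 / (4 * (real (Suc n))\<^sup>2)" for n
  let ?L = "\<lambda>n. LINT \<xi>|lborel. cis (\<xi> \<bullet> x) * complex_of_real (exp (- s n * (norm \<xi>)\<^sup>2)) * fourier f \<xi>"
  have [measurable]: "fourier f \<in> borel_measurable borel" using F by (auto dest: borel_measurable_integrable)
  have s0: "s n > 0" for n by (simp add: s_def)
  show "?L \<longlonglongrightarrow> (LINT \<xi>|lborel. fourier f \<xi> * cis (\<xi> \<bullet> x))"
  proof (rule integral_dominated_convergence)
    show "integrable lborel (\<lambda>\<xi>. norm (fourier f \<xi>))" using F by simp
    show "AE \<xi> in lborel. norm (cis (\<xi> \<bullet> x) * complex_of_real (exp (- s n * (norm \<xi>)\<^sup>2)) * fourier f \<xi>) \<le> norm (fourier f \<xi>)" for n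
      using s0[of n] by (intro AE_I2) (auto simp: norm_mult intro!: mult_left_le_one_le)
    have "s \<longlonglongrightarrow> 0" unfolding s_def by real_asymp
    then have "(\<lambda>n. cis (\<xi> \<bullet> x) * complex_of_real (exp (- s n * (norm \<xi>)\<^sup>2)) * fourier f \<xi>)
       \<longlonglongrightarrow> cis (\<xi> \<bullet> x) * complex_of_real (exp (- 0 * (norm \<xi>)\<^sup>2)) * fourier f \<xi>" for \<xi>
      by (intro tendsto_intros)
    then show "AE \<xi> in lborel. (\<lambda>n. cis (\<xi> \<bullet> x) * complex_of_real (exp (- s n * (norm \<xi>)\<^sup>2)) * fourier f \<xi>)
       \<longlonglongrightarrow> fourier f \<xi> * cis (\<xi> \<bullet> x)"
      by (simp add: mult.commute)
  qed measurable
  have "?L n = (2 * pi) ^ DIM('a) * (LINT y|lborel. f y * complex_of_real ((real (Suc n) / sqrt pi) ^ DIM('a) * exp (- (real (Suc n))\<^sup>2 * (norm (x - y))\<^sup>2)))" for n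
  proof -
    define m where "m = real (Suc n)"
    have m: "m > 0" by (simp add: m_def)
    have s: "s n = 1 / (4 * m\<^sup>2)" by (simp add: s_def m_def)
    have "sqrt (pi / s n) = 2 * m * sqrt pi"
      using m by (simp add: s real_sqrt_mult mult.commute)
    also have "\<dots> = (2 * pi) * (m / sqrt pi)"
      by (simp add: field_simps)
    finally have 1: "sqrt (pi / s n) ^ DIM('a) = (2 * pi) ^ DIM('a) * (m / sqrt pi) ^ DIM('a)"
      by (simp only: power_mult_distrib)
    have 2: "- (norm (x - y))\<^sup>2 / (4 * s n) = - m\<^sup>2 * (norm (x - y))\<^sup>2" for y
      by (simp add: s)
    show ?thesis
      unfolding fourier_gauss_pairing[OF f s0] 1 2 m_def[symmetric]
      by (simp add: mult_ac flip: integral_mult_right_zero)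
  qed
  then show "?L \<longlonglongrightarrow> (2 * pi) ^ DIM('a) * f x"
    using tendsto_mult[OF tendsto_const gauss_approximate_identity[OF cont f]] by simp
qed

section \<open>Smoothness of cosine transforms\<close>

text \<open>Each squared coordinate is at most |x|^2, so the function lies below the product of the
  N one-dimensional functions 1/(1+u^2).\<close>

lemma integrable_one_plus_norm_sq_power:
  "integrable lborel (\<lambda>x::'a::euclidean_space. 1 / (1 + (norm x)\<^sup>2) ^ DIM('a))"
proof (rule Bochner_Integration.integrable_bound)
  have "integrable lborel (\<lambda>u::real. inverse (1 + u\<^sup>2))"
    using integrable_inverse_1_plus_square by (simp add: set_integrable_def einterval_def)
  then have "has_bochner_integral lborel (\<lambda>u::real. inverse (1 + u\<^sup>2)) (LBINT u. inverse (1 + u\<^sup>2))"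
    by (rule has_bochner_integral_integrable)
  then have "has_bochner_integral lborel (\<lambda>x::'a. \<Prod>b\<in>Basis. inverse (1 + (x \<bullet> b)\<^sup>2)) (\<Prod>b\<in>(Basis::'a set). LBINT u. inverse (1 + u\<^sup>2))"
    by (rule has_bochner_integral_lborel_prod)
  then show "integrable lborel (\<lambda>x::'a. \<Prod>b\<in>Basis. inverse (1 + (x \<bullet> b)\<^sup>2))"
    by (simp add: has_bochner_integral_iff)
  show "AE x in lborel. norm (1 / (1 + (norm x)\<^sup>2) ^ DIM('a)) \<le> norm (\<Prod>b\<in>(Basis::'a set). inverse (1 + (x \<bullet> b)\<^sup>2))"
  proof (intro AE_I2)
    fix x :: 'a
    have "(x \<bullet> b)\<^sup>2 \<le> (norm x)\<^sup>2" if "b \<in> Basis" for b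
      using Basis_le_norm[OF that, of x] by (simp add: abs_le_square_iff[symmetric])
    then have "(\<Prod>b\<in>(Basis::'a set). inverse (1 + (norm x)\<^sup>2)) \<le> (\<Prod>b\<in>(Basis::'a set). inverse (1 + (x \<bullet> b)\<^sup>2))"
      by (intro prod_mono conjI le_imp_inverse_le) (auto intro: add_pos_nonneg)
    then show "norm (1 / (1 + (norm x)\<^sup>2) ^ DIM('a)) \<le> norm (\<Prod>b\<in>(Basis::'a set). inverse (1 + (x \<bullet> b)\<^sup>2))"
      by (simp add: divide_inverse power_inverse prod_nonneg abs_prod abs_of_nonneg)
  qed
qed simp

text \<open>All moments are needed, since each derivative of the kernel costs one. The integrand
  times (1+r^2)^N tends to 0 as r = |\<xi>| grows, hence is bounded, and the majorant above
  applies.\<close>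

lemma integrable_moment_exp_powr:
  fixes t \<theta> :: real
  assumes t: "t > 0" and \<theta>: "\<theta> > 0"
  shows "integrable lborel (\<lambda>\<xi>::'a::euclidean_space. norm \<xi> ^ k * exp (- t * norm \<xi> powr \<theta>))"
proof -
  define h where "h r = r ^ k * exp (- t * r powr \<theta>) * (1 + r\<^sup>2) ^ DIM('a)" for r :: real
  have "(h \<longlongrightarrow> 0) at_top"
    unfolding h_def using assms by real_asymp
  then have "eventually (\<lambda>r. h r < 1) at_top"
    by (rule order_tendstoD) simp
  then obtain R where R: "\<And>r. r \<ge> R \<Longrightarrow> h r < 1"
    by (auto simp: eventually_at_top_linorder)
  \<comment> \<open>The entry 1 covers r \<ge> R; the other covers r < R, where the exponential is
    at most 1 and the powers are increasing.\<close>
  define C where "C = max 1 (\<bar>R\<bar> ^ k * (1 + R\<^sup>2) ^ DIM('a))"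
  have bound: "h r \<le> C" if "r \<ge> 0" for r
  proof (cases "r \<ge> R")
    case False
    then have "r ^ k \<le> \<bar>R\<bar> ^ k" "r\<^sup>2 \<le> R\<^sup>2" using that by (auto intro!: power_mono)
    then have "r ^ k \<le> \<bar>R\<bar> ^ k" "(1 + r\<^sup>2) ^ DIM('a) \<le> (1 + R\<^sup>2) ^ DIM('a)" by (auto intro!: power_mono[of "1 + r\<^sup>2"])
    moreover have "exp (- t * r powr \<theta>) \<le> 1" using t by simp
    ultimately have "h r \<le> \<bar>R\<bar> ^ k * 1 * (1 + R\<^sup>2) ^ DIM('a)"
      unfolding h_def using that by (intro mult_mono) auto
    then show ?thesis by (simp add: C_def)
  qed (use R[of r] in \<open>simp add: C_def\<close>)
  show ?thesis
  proof (rule Bochner_Integration.integrable_bound)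
    show "integrable lborel (\<lambda>x::'a. C * (1 / (1 + (norm x)\<^sup>2) ^ DIM('a)))"
      by (intro integrable_mult_right integrable_one_plus_norm_sq_power)
    show "AE \<xi> in lborel. norm (norm \<xi> ^ k * exp (- t * norm \<xi> powr \<theta>)) \<le> norm (C * (1 / (1 + (norm (\<xi>::'a))\<^sup>2) ^ DIM('a)))"
    proof (intro AE_I2)
      fix \<xi> :: 'a
      have "0 < 1 + (norm \<xi>)\<^sup>2" by (simp add: add_pos_nonneg)
      then have "norm \<xi> ^ k * exp (- t * norm \<xi> powr \<theta>) \<le> C * (1 / (1 + (norm \<xi>)\<^sup>2) ^ DIM('a))"
        using bound[of "norm \<xi>"] by (simp add: h_def pos_le_divide_eq)
      moreover have "0 \<le> C" by (simp add: C_def)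
      ultimately show "norm (norm \<xi> ^ k * exp (- t * norm \<xi> powr \<theta>)) \<le> norm (C * (1 / (1 + (norm (\<xi>::'a))\<^sup>2) ^ DIM('a)))"
        by simp
    qed
  qed simp
qed

text \<open>The derivative -sin a is written as the phase shift cos (a + pi/2), so that
  differentiating a cosine transform yields another one. The constant 1 instead of the sharp 1/2
  needs only the mean value theorem and the Lipschitz bound for sin.\<close>

lemma cos_add_remainder: "\<bar>cos (a + h) - cos a - h * cos (a + pi / 2)\<bar> \<le> h\<^sup>2" for a h :: real
proof -
  have pos: "\<bar>cos (a + h) - cos a + h * sin a\<bar> \<le> h\<^sup>2" if h: "h > 0" for a h :: real
  proof -
    have "\<exists>z>a. z < a + h \<and> cos (a + h) - cos a = (a + h - a) * (- sin z)"
      using h by (intro MVT2) (auto intro!: derivative_eq_intros)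
    then obtain z where z: "a < z" "z < a + h" "cos (a + h) - cos a = h * (- sin z)" by auto
    have "\<bar>sin a - sin z\<bar> = 2 * (\<bar>sin ((a - z) / 2)\<bar> * \<bar>cos ((a + z) / 2)\<bar>)"
      by (simp add: sin_diff_sin abs_mult)
    also have "\<dots> \<le> 2 * (\<bar>(a - z) / 2\<bar> * 1)"
      by (intro mult_left_mono mult_mono abs_sin_x_le_abs_x) auto
    also have "\<dots> \<le> h" using z by simp
    finally have "h * \<bar>sin a - sin z\<bar> \<le> h * h" using h by (intro mult_left_mono) auto
    also have "h * \<bar>sin a - sin z\<bar> = \<bar>cos (a + h) - cos a + h * sin a\<bar>"
      using h by (simp add: z(3) abs_mult[of h, simplified abs_of_pos[OF h], symmetric] algebra_simps)
    finally show ?thesis by (simp add: power2_eq_square)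
  qed
  \<comment> \<open>Negative h is reduced to positive h by reflecting both a and h: cos is even and
    sin is odd.\<close>
  have "\<bar>cos (a + h) - cos a + h * sin a\<bar> \<le> h\<^sup>2"
    using pos[of h a] pos[of "- h" "- a"] cos_minus[of "a + h"] by (cases h "0 :: real" rule: linorder_cases) simp_all
  then show ?thesis by (simp add: cos_add)
qed

text \<open>The remainder with h = \<xi> . (y - x) is at most |\<xi>|^2 |y - x|^2, so the second
  moment of \<psi> makes the error quadratic in |y - x|.\<close>

lemma has_derivative_cos_transform:
  fixes \<psi> :: "'a::euclidean_space \<Rightarrow> real"
  assumes [measurable]: "\<psi> \<in> borel_measurable borel"
    and int: "\<And>k. integrable lborel (\<lambda>\<xi>. norm \<xi> ^ k * \<psi> \<xi>)"
  shows "((\<lambda>x. LINT \<xi>|lborel. \<psi> \<xi> * cos (\<xi> \<bullet> x + c)) has_derivative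
          (\<lambda>v. LINT \<xi>|lborel. (\<psi> \<xi> * (\<xi> \<bullet> v)) * cos (\<xi> \<bullet> x + (c + pi / 2)))) (at x)"
proof -
  have i0: "integrable lborel (\<lambda>\<xi>. \<psi> \<xi> * cos (\<xi> \<bullet> x + c))" for x c
    by (rule Bochner_Integration.integrable_bound[OF int[of 0]]) (auto simp: abs_mult intro!: mult_left_le)
  have i1: "integrable lborel (\<lambda>\<xi>. (\<psi> \<xi> * (\<xi> \<bullet> v)) * cos (\<xi> \<bullet> x + c))" for v x c
  proof (rule Bochner_Integration.integrable_bound)
    show "integrable lborel (\<lambda>\<xi>. norm v * (norm \<xi> ^ 1 * \<psi> \<xi>))" by (intro integrable_mult_right int)
    show "AE \<xi> in lborel. norm ((\<psi> \<xi> * (\<xi> \<bullet> v)) * cos (\<xi> \<bullet> x + c)) \<le> norm (norm v * (norm \<xi> ^ 1 * \<psi> \<xi>))"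
    proof (intro AE_I2)
      fix \<xi> :: 'a
      have "\<bar>\<psi> \<xi>\<bar> * \<bar>\<xi> \<bullet> v\<bar> * \<bar>cos (\<xi> \<bullet> x + c)\<bar> \<le> \<bar>\<psi> \<xi>\<bar> * (norm \<xi> * norm v) * 1"
        by (intro mult_mono mult_left_mono Cauchy_Schwarz_ineq2) auto
      then show "norm ((\<psi> \<xi> * (\<xi> \<bullet> v)) * cos (\<xi> \<bullet> x + c)) \<le> norm (norm v * (norm \<xi> ^ 1 * \<psi> \<xi>))"
        by (simp add: abs_mult mult_ac)
    qed
  qed measurable
  have i2: "integrable lborel (\<lambda>\<xi>. norm \<xi> ^ 2 * \<bar>\<psi> \<xi>\<bar>)"
    using integrable_norm[OF int[of 2]] by (simp add: abs_mult)
  define D where "D v = (LINT \<xi>|lborel. (\<psi> \<xi> * (\<xi> \<bullet> v)) * cos (\<xi> \<bullet> x + (c + pi / 2)))" for v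
  define M where "M = (LINT \<xi>|lborel. norm \<xi> ^ 2 * \<bar>\<psi> \<xi>\<bar>)"
  have "linear D"
  proof
    show "D (v + w) = D v + D w" for v w
      unfolding D_def by (subst Bochner_Integration.integral_add[symmetric, OF i1 i1]) (simp add: inner_add_right algebra_simps)
    show "D (r *\<^sub>R v) = r *\<^sub>R D v" for r v
      unfolding D_def by (simp add: mult_ac flip: integral_mult_right_zero)
  qed
  then have bl: "bounded_linear D" by (simp add: linear_linear)
  have "((\<lambda>x. LINT \<xi>|lborel. \<psi> \<xi> * cos (\<xi> \<bullet> x + c)) has_derivative D) (at x)"
  proof (rule has_derivativeI_sandwich[OF zero_less_one bl])
    show "((\<lambda>y. M * norm (y - x)) \<longlongrightarrow> 0) (at x)"
      by (rule tendsto_eq_intros refl | simp)+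
    fix y :: 'a assume y: "y \<noteq> x"
    let ?F = "\<lambda>x. LINT \<xi>|lborel. \<psi> \<xi> * cos (\<xi> \<bullet> x + c)"
    have "?F y - ?F x - D (y - x) = (LINT \<xi>|lborel. \<psi> \<xi> * cos (\<xi> \<bullet> y + c) - \<psi> \<xi> * cos (\<xi> \<bullet> x + c) - (\<psi> \<xi> * (\<xi> \<bullet> (y - x))) * cos (\<xi> \<bullet> x + (c + pi / 2)))"
      unfolding D_def by (simp add: i0 i1)
    also have "norm \<dots> \<le> (LINT \<xi>|lborel. (norm (y - x))\<^sup>2 * (norm \<xi> ^ 2 * \<bar>\<psi> \<xi>\<bar>))"
    proof (rule Bochner_Integration.integral_norm_bound_integral)
      fix \<xi>
      define a h where "a = \<xi> \<bullet> x + c" and "h = \<xi> \<bullet> (y - x)"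
      have "h\<^sup>2 \<le> (norm \<xi> * norm (y - x))\<^sup>2"
        using Cauchy_Schwarz_ineq2[of \<xi> "y - x"] by (simp add: h_def abs_le_square_iff[symmetric])
      have ah: "\<xi> \<bullet> y + c = a + h" "\<xi> \<bullet> x + (c + pi / 2) = a + pi / 2" by (simp_all add: a_def h_def inner_diff_right)
      have "norm (\<psi> \<xi> * cos (a + h) - \<psi> \<xi> * cos a - (\<psi> \<xi> * h) * cos (a + pi / 2))
         = \<bar>\<psi> \<xi>\<bar> * \<bar>cos (a + h) - cos a - h * cos (a + pi / 2)\<bar>"
        by (simp add: right_diff_distrib mult.assoc flip: abs_mult)
      also have "\<dots> \<le> \<bar>\<psi> \<xi>\<bar> * h\<^sup>2"
        by (intro mult_left_mono cos_add_remainder) simp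
      also have "\<dots> \<le> \<bar>\<psi> \<xi>\<bar> * (norm \<xi> * norm (y - x))\<^sup>2" by (intro mult_left_mono) (use \<open>h\<^sup>2 \<le> _\<close> in auto)
      finally show "norm (\<psi> \<xi> * cos (\<xi> \<bullet> y + c) - \<psi> \<xi> * cos (\<xi> \<bullet> x + c) - (\<psi> \<xi> * (\<xi> \<bullet> (y - x))) * cos (\<xi> \<bullet> x + (c + pi / 2)))
          \<le> (norm (y - x))\<^sup>2 * (norm \<xi> ^ 2 * \<bar>\<psi> \<xi>\<bar>)"
        unfolding ah a_def[symmetric] h_def[symmetric] by (simp add: power_mult_distrib mult_ac)
    qed (use i0 i1 i2 in auto)
    also have "\<dots> = (norm (y - x))\<^sup>2 * M" by (simp add: M_def)
    finally have "norm (?F y - ?F x - D (y - x)) \<le> (norm (y - x))\<^sup>2 * M" .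
    then show "norm (?F y - ?F x - D (y - x)) / norm (y - x) \<le> M * norm (y - x)"
      using y by (simp add: divide_le_eq power2_eq_square mult_ac)
  qed
  moreover have "D = (\<lambda>v. LINT \<xi>|lborel. (\<psi> \<xi> * (\<xi> \<bullet> v)) * cos (\<xi> \<bullet> x + (c + pi / 2)))"
    by (rule ext) (simp only: D_def)
  ultimately show ?thesis by simp
qed

text \<open>Differentiation in direction v replaces \<psi> by \<psi> times \<xi> . v and c by c +
  pi/2. The form is kept and the moments shift by one, so the induction generalises over both;
  \<psi> must be allowed to change sign.\<close>

lemma C_k_cos_transform:
  fixes \<psi> :: "'a::euclidean_space \<Rightarrow> real"
  assumes "\<psi> \<in> borel_measurable borel" and "\<And>k. integrable lborel (\<lambda>\<xi>. norm \<xi> ^ k * \<psi> \<xi>)"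
  shows "C_k n (\<lambda>x. LINT \<xi>|lborel. \<psi> \<xi> * cos (\<xi> \<bullet> x + c))"
  using assms(1,2)
proof (induction n arbitrary: \<psi> c)
  case 0
  then show ?case
    by (simp add: continuous_at_imp_continuous_on has_derivative_continuous[OF has_derivative_cos_transform])
next
  case (Suc n)
  note [measurable] = Suc.prems(1)
  note D = has_derivative_cos_transform[OF Suc.prems]
  have "C_k n (\<lambda>x. LINT \<xi>|lborel. (\<psi> \<xi> * (\<xi> \<bullet> v)) * cos (\<xi> \<bullet> x + (c + pi / 2)))" for v
  proof (rule Suc.IH)
    show "integrable lborel (\<lambda>\<xi>. norm \<xi> ^ k * (\<psi> \<xi> * (\<xi> \<bullet> v)))" for k
    proof (rule Bochner_Integration.integrable_bound)
      show "integrable lborel (\<lambda>\<xi>. norm v * (norm \<xi> ^ Suc k * \<psi> \<xi>))" by (intro integrable_mult_right Suc.prems)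
      show "AE \<xi> in lborel. norm (norm \<xi> ^ k * (\<psi> \<xi> * (\<xi> \<bullet> v))) \<le> norm (norm v * (norm \<xi> ^ Suc k * \<psi> \<xi>))"
      proof (intro AE_I2)
        fix \<xi> :: 'a
        have "norm \<xi> ^ k * \<bar>\<psi> \<xi>\<bar> * \<bar>\<xi> \<bullet> v\<bar> \<le> norm \<xi> ^ k * \<bar>\<psi> \<xi>\<bar> * (norm \<xi> * norm v)"
          by (intro mult_left_mono Cauchy_Schwarz_ineq2) auto
        then show "norm (norm \<xi> ^ k * (\<psi> \<xi> * (\<xi> \<bullet> v))) \<le> norm (norm v * (norm \<xi> ^ Suc k * \<psi> \<xi>))"
          by (simp add: abs_mult mult_ac)
      qed
    qed measurable
  qed measurable
  then show ?case
    by (auto simp: differentiable_on_def frechet_derivative_at[OF D, symmetric] intro!: differentiableI D)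
qed

section \<open>Limits of Gaussian mixtures\<close>

text \<open>Two properties of nonnegative mixtures of centred Gaussians that are linear, hence survive sums and
  pointwise limits. The second one is log-convexity in \<open>|x|\<^sup>2\<close>, linearised by the AM-GM inequality; it
  propagates strict positivity from a neighbourhood of the origin to the whole space.\<close>

definition mixture_like :: "('a::euclidean_space \<Rightarrow> real) \<Rightarrow> bool" where
  "mixture_like h \<longleftrightarrow> (\<forall>x y. norm x \<le> norm y \<longrightarrow> 0 \<le> h y \<and> h y \<le> h x) \<and>
     (\<forall>x l. l > 0 \<longrightarrow> 2 * h x \<le> l * h 0 + h (sqrt 2 *\<^sub>R x) / l)"

lemma mixture_like_add:
  assumes g: "mixture_like g" and h: "mixture_like h"
  shows "mixture_like (\<lambda>x. g x + h x)"
  unfolding mixture_like_def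
proof (intro conjI allI impI)
  fix x y :: 'a assume "norm x \<le> norm y"
  then show "0 \<le> g y + h y" "g y + h y \<le> g x + h x"
    using g h unfolding mixture_like_def by (auto intro: add_nonneg_nonneg add_mono)
next
  fix x :: 'a and l :: real assume "l > 0"
  then have "2 * g x \<le> l * g 0 + g (sqrt 2 *\<^sub>R x) / l" "2 * h x \<le> l * h 0 + h (sqrt 2 *\<^sub>R x) / l"
    using g h unfolding mixture_like_def by blast+
  then show "2 * (g x + h x) \<le> l * (g 0 + h 0) + (g (sqrt 2 *\<^sub>R x) + h (sqrt 2 *\<^sub>R x)) / l"
    by (simp add: algebra_simps add_divide_distrib)
qed

lemma mixture_like_cmult: "mixture_like h \<Longrightarrow> 0 \<le> c \<Longrightarrow> mixture_like (\<lambda>x. c * h x)"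
proof -
  assume h: "mixture_like h" and c: "0 \<le> c"
  have "c * (2 * h x) \<le> c * (l * h 0 + h (sqrt 2 *\<^sub>R x) / l)" if "l > 0" for x l
    using h c that by (intro mult_left_mono) (auto simp: mixture_like_def)
  then show ?thesis
    using h c unfolding mixture_like_def by (auto simp: algebra_simps mult_left_mono)
qed

lemma mixture_like_lim:
  assumes h: "\<And>n::nat. mixture_like (h n)" and lim: "\<And>x. (\<lambda>n. h n x) \<longlonglongrightarrow> g x"
  shows "mixture_like g"
  unfolding mixture_like_def
proof (intro conjI allI impI)
  fix x y :: 'a assume "norm x \<le> norm y"
  then have "0 \<le> h n y" "h n y \<le> h n x" for n using h[of n] by (auto simp: mixture_like_def)
  then show "0 \<le> g y" "g y \<le> g x"
    by (auto intro!: LIMSEQ_le_const[OF lim] LIMSEQ_le[OF lim lim])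
next
  fix x :: 'a and l :: real assume "l > 0"
  then have "2 * h n x \<le> l * h n 0 + h n (sqrt 2 *\<^sub>R x) / l" for n using h[of n] by (auto simp: mixture_like_def)
  moreover have "(\<lambda>n. 2 * h n x) \<longlonglongrightarrow> 2 * g x" "(\<lambda>n. l * h n 0 + h n (sqrt 2 *\<^sub>R x) / l) \<longlonglongrightarrow> l * g 0 + g (sqrt 2 *\<^sub>R x) / l"
    using \<open>l > 0\<close> by (auto intro!: tendsto_intros lim)
  ultimately show "2 * g x \<le> l * g 0 + g (sqrt 2 *\<^sub>R x) / l"
    using LIMSEQ_le by blast
qed

text \<open>Scaling the argument by sqrt 2 squares a centred Gaussian, which turns the second
  property into (l - e)^2 \<ge> 0.\<close>

lemma mixture_like_gauss:
  assumes "a \<ge> 0"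
  shows "mixture_like (\<lambda>x::'a::euclidean_space. exp (- a * (norm x)\<^sup>2))"
  unfolding mixture_like_def
proof (intro conjI allI impI)
  fix x y :: 'a assume "norm x \<le> norm y"
  then show "exp (- a * (norm y)\<^sup>2) \<le> exp (- a * (norm x)\<^sup>2)"
    using assms by (auto intro!: mult_left_mono power_mono)
next
  fix x :: 'a and l :: real assume l: "l > 0"
  define e where "e = exp (- a * (norm x)\<^sup>2)"
  have e2: "exp (- a * (norm (sqrt 2 *\<^sub>R x))\<^sup>2) = e\<^sup>2"
    by (simp add: e_def power_mult_distrib flip: exp_double)
  have "0 \<le> (l - e)\<^sup>2" by simp
  then have "2 * e \<le> l + e\<^sup>2 / l" using l by (simp add: field_simps power2_eq_square)
  then show "2 * exp (- a * (norm x)\<^sup>2) \<le> l * exp (- a * (norm (0::'a))\<^sup>2) + exp (- a * (norm (sqrt 2 *\<^sub>R x))\<^sup>2) / l"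
    unfolding e2 by (simp add: e_def)
qed simp

lemma mixture_like_pos:
  fixes h :: "'a::euclidean_space \<Rightarrow> real"
  assumes h: "mixture_like h" and cont: "isCont h 0" and h0: "h 0 > 0"
  shows "h x > 0"
proof -
  have double: "h (sqrt 2 *\<^sub>R x) > 0" if "h x > 0" for x
  proof (rule ccontr)
    assume "\<not> h (sqrt 2 *\<^sub>R x) > 0"
    then have "h (sqrt 2 *\<^sub>R x) = 0" using h unfolding mixture_like_def by (metis order_refl order_le_less)
    \<comment> \<open>With l = h x / h 0 the first term on the right is h x and the second vanishes,
      leaving 2 h x \<le> h x.\<close>
    moreover have "2 * h x \<le> (h x / h 0) * h 0 + h (sqrt 2 *\<^sub>R x) / (h x / h 0)"
      using h that h0 unfolding mixture_like_def by (metis divide_pos_pos)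
    ultimately show False using that h0 by simp
  qed
  have pow: "h x > 0 \<Longrightarrow> h ((sqrt 2 ^ n) *\<^sub>R x) > 0" for n x
    by (induction n) (auto simp: double simp flip: scaleR_scaleR)
  \<comment> \<open>Contraction by powers of 1/sqrt 2 brings x to where continuity at 0 gives
    positivity; \<open>pow\<close> carries it back.\<close>
  have "(\<lambda>n. (1 / sqrt 2) ^ n *\<^sub>R x) \<longlonglongrightarrow> 0 *\<^sub>R x"
    by (intro tendsto_intros LIMSEQ_power_zero) (simp add: real_less_rsqrt)
  then have "(\<lambda>n. h ((1 / sqrt 2) ^ n *\<^sub>R x)) \<longlonglongrightarrow> h 0"
    using cont by (intro isCont_tendsto_compose[of 0 h]) auto
  then have "eventually (\<lambda>n. h ((1 / sqrt 2) ^ n *\<^sub>R x) > 0) sequentially"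
    using h0 by (rule order_tendstoD)
  then obtain n where "h ((1 / sqrt 2) ^ n *\<^sub>R x) > 0"
    by (auto simp: eventually_sequentially)
  from pow[OF this, of n] show ?thesis
    by (simp add: power_divide)
qed

text \<open>Here \<open>\<phi>\<close> is a function of \<open>r = |\<xi>|\<^sup>2\<close>, only relevant for \<open>r > 0\<close>. The factor \<open>exp (- d |\<xi>|\<^sup>2)\<close> makes all
  integrals converge, so that bounded pointwise limits of \<open>\<phi>\<close> are harmless; in particular \<open>\<phi> = 1\<close>, the
  transform of a point mass, is allowed.\<close>

definition gauss_mixing :: "'a::euclidean_space itself \<Rightarrow> (real \<Rightarrow> real) \<Rightarrow> bool" where
  "gauss_mixing _ \<phi> \<longleftrightarrow> \<phi> \<in> borel_measurable borel \<and> (\<exists>B. \<forall>r>0. \<bar>\<phi> r\<bar> \<le> B) \<and>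
     (\<forall>d>0. mixture_like (\<lambda>x::'a. LINT \<xi>|lborel. \<phi> ((norm \<xi>)\<^sup>2) * exp (- d * (norm \<xi>)\<^sup>2) * cos (\<xi> \<bullet> x)))"

section \<open>Closure properties of \<open>gauss_mixing\<close>\<close>

lemma AE_lborel_neq0: "AE \<xi>::'a::euclidean_space in lborel. \<xi> \<noteq> 0"
  by (rule AE_lborel_singleton)

lemma integrable_mult_gauss_cos:
  fixes x :: "'a::euclidean_space"
  assumes [measurable]: "\<phi> \<in> borel_measurable borel" and B: "\<And>r. r > 0 \<Longrightarrow> \<bar>\<phi> r\<bar> \<le> B" and d: "d > 0"
  shows "integrable lborel (\<lambda>\<xi>. \<phi> ((norm \<xi>)\<^sup>2) * exp (- d * (norm \<xi>)\<^sup>2) * cos (\<xi> \<bullet> x))"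
proof (rule Bochner_Integration.integrable_bound)
  show "integrable lborel (\<lambda>\<xi>::'a. B * exp (- d * (norm \<xi>)\<^sup>2))"
    using has_bochner_integral_gauss[OF d, where 'a='a] by (auto simp: has_bochner_integral_iff)
  show "AE \<xi> in lborel. norm (\<phi> ((norm \<xi>)\<^sup>2) * exp (- d * (norm \<xi>)\<^sup>2) * cos (\<xi> \<bullet> x)) \<le> norm (B * exp (- d * (norm \<xi>)\<^sup>2))"
    using AE_lborel_neq0
  proof eventually_elim
    case (elim \<xi>)
    then have *: "\<bar>\<phi> ((norm \<xi>)\<^sup>2)\<bar> \<le> B" by (intro B) simp
    then have "\<bar>\<phi> ((norm \<xi>)\<^sup>2)\<bar> * exp (- d * (norm \<xi>)\<^sup>2) * \<bar>cos (\<xi> \<bullet> x)\<bar> \<le> B * exp (- d * (norm \<xi>)\<^sup>2) * 1"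
      by (intro mult_mono) (auto intro: order_trans[OF abs_ge_zero])
    then show ?case using * by (simp add: abs_mult)
  qed
qed measurable

text \<open>The transform of a Gaussian is a Gaussian. The other symbols arise from this one by
  factors exp (-s r), nonnegative combinations and limits.\<close>

lemma gauss_mixing_one: "gauss_mixing TYPE('a::euclidean_space) (\<lambda>_. 1)"
  unfolding gauss_mixing_def
proof (intro conjI allI impI)
  fix d :: real assume d: "d > 0"
  have "(LINT \<xi>|lborel. 1 * exp (- d * (norm \<xi>)\<^sup>2) * cos (\<xi> \<bullet> x)) = sqrt (pi / d) ^ DIM('a) * exp (- (1 / (4 * d)) * (norm x)\<^sup>2)" for x :: 'a
  proof -
    have i: "has_bochner_integral lborel (\<lambda>u. cis (u \<bullet> x) * complex_of_real (exp (- d * (norm u)\<^sup>2)))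
           (complex_of_real (sqrt (pi / d) ^ DIM('a) * exp (- (norm x)\<^sup>2 / (4 * d))))"
      by (rule has_bochner_integral_gauss_cis[OF d])
    have "(LINT \<xi>|lborel. Re (cis (\<xi> \<bullet> x) * complex_of_real (exp (- d * (norm \<xi>)\<^sup>2)))) = sqrt (pi / d) ^ DIM('a) * exp (- (norm x)\<^sup>2 / (4 * d))"
      using i by (subst integral_Re) (auto simp only: has_bochner_integral_iff Re_complex_of_real)
    then show ?thesis by (simp add: mult.commute)
  qed
  then show "mixture_like (\<lambda>x::'a. LINT \<xi>|lborel. 1 * exp (- d * (norm \<xi>)\<^sup>2) * cos (\<xi> \<bullet> x))"
    using d by (simp only:) (intro mixture_like_cmult mixture_like_gauss, auto)
qed auto

lemma gauss_mixing_add: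
  assumes "gauss_mixing TYPE('a::euclidean_space) \<phi>" "gauss_mixing TYPE('a) \<psi>"
  shows "gauss_mixing TYPE('a) (\<lambda>r. \<phi> r + \<psi> r)"
proof -
  from assms obtain B C where B: "\<And>r. r > 0 \<Longrightarrow> \<bar>\<phi> r\<bar> \<le> B" and C: "\<And>r. r > 0 \<Longrightarrow> \<bar>\<psi> r\<bar> \<le> C"
    and m [measurable]: "\<phi> \<in> borel_measurable borel" "\<psi> \<in> borel_measurable borel"
    unfolding gauss_mixing_def by metis
  show ?thesis unfolding gauss_mixing_def
  proof (intro conjI allI impI)
    show "\<exists>B. \<forall>r>0. \<bar>\<phi> r + \<psi> r\<bar> \<le> B"
      using B C by (intro exI[of _ "B + C"]) (auto intro: order_trans[OF abs_triangle_ineq] add_mono)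
    fix d :: real assume d: "d > 0"
    have "mixture_like (\<lambda>x::'a. (LINT \<xi>|lborel. \<phi> ((norm \<xi>)\<^sup>2) * exp (- d * (norm \<xi>)\<^sup>2) * cos (\<xi> \<bullet> x))
       + (LINT \<xi>|lborel. \<psi> ((norm \<xi>)\<^sup>2) * exp (- d * (norm \<xi>)\<^sup>2) * cos (\<xi> \<bullet> x)))"
      using assms d by (intro mixture_like_add) (auto simp: gauss_mixing_def)
    then show "mixture_like (\<lambda>x::'a. LINT \<xi>|lborel. (\<phi> ((norm \<xi>)\<^sup>2) + \<psi> ((norm \<xi>)\<^sup>2)) * exp (- d * (norm \<xi>)\<^sup>2) * cos (\<xi> \<bullet> x))"
      by (subst (asm) Bochner_Integration.integral_add[symmetric, OF integrable_mult_gauss_cos[OF m(1) B d] integrable_mult_gauss_cos[OF m(2) C d]])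
        (simp_all add: distrib_right)
  qed measurable
qed

text \<open>The factor exp (-s r) only raises the damping from d to s + d, which is covered because
  \<open>gauss_mixing\<close> quantifies over every d > 0.\<close>

lemma gauss_mixing_cmult_exp:
  assumes "gauss_mixing TYPE('a::euclidean_space) \<phi>" and c: "c \<ge> 0" and s: "s \<ge> 0"
  shows "gauss_mixing TYPE('a) (\<lambda>r. c * exp (- s * r) * \<phi> r)"
proof -
  from assms(1) obtain B where B: "\<And>r. r > 0 \<Longrightarrow> \<bar>\<phi> r\<bar> \<le> B"
    and m [measurable]: "\<phi> \<in> borel_measurable borel"
    unfolding gauss_mixing_def by metis
  show ?thesis unfolding gauss_mixing_def
  proof (intro conjI allI impI exI[of _ "c * 1 * B"])
    show "\<bar>c * exp (- s * r) * \<phi> r\<bar> \<le> c * 1 * B" if "r > 0" for r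
      unfolding abs_mult using B[OF that] c s that by (intro mult_mono) (auto simp: mult_nonneg_nonneg)
    fix d :: real assume d: "d > 0"
    have "mixture_like (\<lambda>x::'a. c * (LINT \<xi>|lborel. \<phi> ((norm \<xi>)\<^sup>2) * exp (- (s + d) * (norm \<xi>)\<^sup>2) * cos (\<xi> \<bullet> x)))"
      using assms(1) d c s unfolding gauss_mixing_def by (intro mixture_like_cmult) (blast intro: add_nonneg_pos)+
    moreover have "c * (\<phi> r * exp (- (s + d) * r) * u) = c * exp (- s * r) * \<phi> r * exp (- d * r) * u" for r u
      by (simp add: distrib_right exp_add exp_diff exp_minus field_simps)
    ultimately show "mixture_like (\<lambda>x::'a. LINT \<xi>|lborel. c * exp (- s * (norm \<xi>)\<^sup>2) * \<phi> ((norm \<xi>)\<^sup>2) * exp (- d * (norm \<xi>)\<^sup>2) * cos (\<xi> \<bullet> x))"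
      by (simp only: integral_mult_right_zero[symmetric])
  qed measurable
qed

text \<open>Dominated convergence with majorant B exp (-d |\<xi>|^2); the point \<xi> = 0 is a null
  set, so nothing is asked at r = 0.\<close>

lemma gauss_mixing_lim:
  assumes gm: "\<And>n::nat. gauss_mixing TYPE('a::euclidean_space) (\<phi> n)" and B: "\<And>n r. r > 0 \<Longrightarrow> \<bar>\<phi> n r\<bar> \<le> B"
    and lim: "\<And>r. r > 0 \<Longrightarrow> (\<lambda>n. \<phi> n r) \<longlonglongrightarrow> \<psi> r" and [measurable]: "\<psi> \<in> borel_measurable borel"
  shows "gauss_mixing TYPE('a) \<psi>"
  unfolding gauss_mixing_def
proof (intro conjI allI impI exI[of _ B])
  have m [measurable]: "\<phi> n \<in> borel_measurable borel" for n using gm[of n] by (simp add: gauss_mixing_def)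
  show "\<bar>\<psi> r\<bar> \<le> B" if "r > 0" for r
    using that B by (intro LIMSEQ_le_const2[OF tendsto_rabs[OF lim]]) auto
  fix d :: real assume d: "d > 0"
  show "mixture_like (\<lambda>x::'a. LINT \<xi>|lborel. \<psi> ((norm \<xi>)\<^sup>2) * exp (- d * (norm \<xi>)\<^sup>2) * cos (\<xi> \<bullet> x))"
  proof (rule mixture_like_lim)
    show "mixture_like (\<lambda>x::'a. LINT \<xi>|lborel. \<phi> n ((norm \<xi>)\<^sup>2) * exp (- d * (norm \<xi>)\<^sup>2) * cos (\<xi> \<bullet> x))" for n
      using gm[of n] d by (simp add: gauss_mixing_def)
    show "(\<lambda>n. LINT \<xi>|lborel. \<phi> n ((norm \<xi>)\<^sup>2) * exp (- d * (norm \<xi>)\<^sup>2) * cos (\<xi> \<bullet> x))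
        \<longlonglongrightarrow> (LINT \<xi>|lborel. \<psi> ((norm \<xi>)\<^sup>2) * exp (- d * (norm \<xi>)\<^sup>2) * cos (\<xi> \<bullet> x))" for x :: 'a
    proof (rule integral_dominated_convergence)
      show "integrable lborel (\<lambda>\<xi>::'a. B * exp (- d * (norm \<xi>)\<^sup>2))"
        using has_bochner_integral_gauss[OF d, where 'a='a] by (auto simp: has_bochner_integral_iff)
      show "AE \<xi> in lborel. (\<lambda>n. \<phi> n ((norm \<xi>)\<^sup>2) * exp (- d * (norm \<xi>)\<^sup>2) * cos (\<xi> \<bullet> x))
          \<longlonglongrightarrow> \<psi> ((norm \<xi>)\<^sup>2) * exp (- d * (norm \<xi>)\<^sup>2) * cos (\<xi> \<bullet> x)"
        using AE_lborel_neq0 by eventually_elim (intro tendsto_mult tendsto_const lim, simp)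
      show "AE \<xi> in lborel. norm (\<phi> n ((norm \<xi>)\<^sup>2) * exp (- d * (norm \<xi>)\<^sup>2) * cos (\<xi> \<bullet> x)) \<le> B * exp (- d * (norm \<xi>)\<^sup>2)" for n
        using AE_lborel_neq0
      proof eventually_elim
        case (elim \<xi>)
        then have *: "\<bar>\<phi> n ((norm \<xi>)\<^sup>2)\<bar> \<le> B" by (intro B) simp
        then have "\<bar>\<phi> n ((norm \<xi>)\<^sup>2)\<bar> * exp (- d * (norm \<xi>)\<^sup>2) * \<bar>cos (\<xi> \<bullet> x)\<bar> \<le> B * exp (- d * (norm \<xi>)\<^sup>2) * 1"
          by (intro mult_mono) (auto intro: order_trans[OF abs_ge_zero])
        then show ?case by (simp add: abs_mult)
      qed
    qed measurable
  qed
qed fact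

text \<open>Takes the place of a general product rule: it is the multiplication by which a power of
  the symbol is built up one factor at a time.\<close>

lemma gauss_mixing_mult_poly_exp:
  assumes \<phi>: "gauss_mixing TYPE('a::euclidean_space) \<phi>" and b: "\<And>k. b k \<ge> (0::real)" and s: "s \<ge> 0"
  shows "gauss_mixing TYPE('a) (\<lambda>r. (\<Sum>k<K. b k * exp (- s * r) ^ k) * \<phi> r)"
proof (induction K)
  case 0
  show ?case using gauss_mixing_cmult_exp[OF \<phi>, of 0 0] by simp
next
  case (Suc K)
  have "gauss_mixing TYPE('a) (\<lambda>r. b K * exp (- (real K * s) * r) * \<phi> r)"
    by (intro gauss_mixing_cmult_exp \<phi> b) (use s in auto)
  from gauss_mixing_add[OF Suc this] show ?case
    by (simp add: distrib_right mult.assoc flip: exp_of_nat_mult)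
qed

text \<open>For 0 < \<alpha> \<le> 1 these are the probabilities of the Sibuya law, with generating
  function 1 - (1 - q)^\<alpha>; the entry at 0 is 0 because the constant terms cancel.\<close>

definition sibuya :: "real \<Rightarrow> nat \<Rightarrow> real" where
  "sibuya \<alpha> k = (if k = 0 then 0 else - ((\<alpha> gchoose k) * (- 1) ^ k))"

text \<open>Writing c_k for the coefficients, c_1 = \<alpha> and (k+2) c_(k+2) = (k+1-\<alpha>)
  c_(k+1), where the factor on the right is nonnegative because \<alpha> \<le> 1.\<close>

lemma sibuya_nonneg:
  assumes "0 < \<alpha>" "\<alpha> \<le> 1"
  shows "sibuya \<alpha> k \<ge> 0"
proof -
  have "sibuya \<alpha> (Suc k) \<ge> 0" for k
  proof (induction k)
    case 0
    then show ?case using assms by (simp add: sibuya_def)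
  next
    case (Suc k)
    have "real (Suc (Suc k)) * (\<alpha> gchoose Suc (Suc k)) = (\<alpha> - real (Suc k)) * (\<alpha> gchoose Suc k)"
      using gbinomial_mult_1[of \<alpha> "Suc k"] by (simp add: algebra_simps)
    from arg_cong[OF this, of "\<lambda>x. x * (- 1) ^ Suc k"]
    have "real (Suc (Suc k)) * sibuya \<alpha> (Suc (Suc k)) = (real (Suc k) - \<alpha>) * sibuya \<alpha> (Suc k)"
      unfolding sibuya_def by (simp add: algebra_simps)
    also have "\<dots> \<ge> 0" using Suc assms by (intro mult_nonneg_nonneg) auto
    finally show ?case by (simp add: zero_le_mult_iff)
  qed
  then show ?thesis by (cases k) (auto simp: sibuya_def)
qed

lemma sibuya_sums:
  assumes "0 < \<alpha>" "\<bar>q\<bar> < 1"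
  shows "(\<lambda>k. sibuya \<alpha> k * q ^ k) sums (1 - (1 - q) powr \<alpha>)"
proof -
  have "(\<lambda>k. (\<alpha> gchoose k) * (- q) ^ k) sums (1 + (- q)) powr \<alpha>"
    using assms by (intro gen_binomial_real) simp
  from sums_diff[OF sums_single[of 0 "\<lambda>_. 1"] this]
  have "(\<lambda>k. (if k = 0 then 1 else 0) - (\<alpha> gchoose k) * (- q) ^ k) sums (1 - (1 - q) powr \<alpha>)" by simp
  moreover have "(if k = 0 then 1 else 0) - (\<alpha> gchoose k) * (- q) ^ k = sibuya \<alpha> k * q ^ k" for k
    by (subst power_minus) (simp add: sibuya_def)
  ultimately show ?thesis by simp
qed

text \<open>In the induction one further factor w is replaced by the partial sums of its series.
  These increase to w \<le> 1, so the products stay bounded by 1 and the limit lemma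
  applies.\<close>

lemma gauss_mixing_sibuya_power:
  assumes \<alpha>: "0 < \<alpha>" "\<alpha> \<le> 1" and s: "s > 0"
  shows "gauss_mixing TYPE('a::euclidean_space) (\<lambda>r. (1 - (1 - exp (- s * r)) powr \<alpha>) ^ n)"
proof (induction n)
  case 0
  then show ?case using gauss_mixing_one by simp
next
  case (Suc n)
  define w where "w r = 1 - (1 - exp (- s * r)) powr \<alpha>" for r
  have w: "0 \<le> w r" "w r \<le> 1" if "r > 0" for r
    using that s \<alpha> by (auto simp: w_def intro!: powr_le1)
  have wn: "0 \<le> w r ^ k" "w r ^ k \<le> 1" if "r > 0" for r k
    using w[OF that] by (auto intro!: power_le_one)
  define S where "S K r = (\<Sum>k<K. sibuya \<alpha> k * exp (- s * r) ^ k)" for K r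
  have sums: "(\<lambda>k. sibuya \<alpha> k * exp (- s * r) ^ k) sums w r" if "r > 0" for r
    unfolding w_def using that s \<alpha> by (intro sibuya_sums) auto
  have S: "0 \<le> S K r" "S K r \<le> 1" if "r > 0" for K r
  proof -
    show "0 \<le> S K r" unfolding S_def by (intro sum_nonneg mult_nonneg_nonneg sibuya_nonneg \<alpha>) auto
    have "S K r \<le> w r" unfolding S_def sums_unique[OF sums[OF that]]
      by (intro sum_le_suminf sums_summable[OF sums[OF that]]) (auto intro!: mult_nonneg_nonneg sibuya_nonneg \<alpha>)
    then show "S K r \<le> 1" using w[OF that] by simp
  qed
  have "gauss_mixing TYPE('a) (\<lambda>r. w r * w r ^ n)"
  proof (rule gauss_mixing_lim)
    show "gauss_mixing TYPE('a) (\<lambda>r. S K r * w r ^ n)" for K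
      unfolding S_def using Suc s by (intro gauss_mixing_mult_poly_exp sibuya_nonneg \<alpha>) (simp_all add: w_def)
    show "\<bar>S K r * w r ^ n\<bar> \<le> 1" if "r > 0" for K r
      using mult_mono[OF S(2)[OF that, of K] wn(2)[OF that, of n]] S[OF that, of K] wn[OF that, of n] by (simp add: abs_mult)
    show "(\<lambda>K. S K r * w r ^ n) \<longlonglongrightarrow> w r * w r ^ n" if "r > 0" for r
      using sums[OF that] by (intro tendsto_mult tendsto_const) (simp add: sums_def S_def)
    show "(\<lambda>r. w r * w r ^ n) \<in> borel_measurable borel" unfolding w_def by measurable
  qed
  then show ?case by (simp add: w_def)
qed

lemma gauss_mixing_exp_powr:
  assumes \<alpha>: "0 < \<alpha>" "\<alpha> \<le> 1" and t: "t > 0"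
  shows "gauss_mixing TYPE('a::euclidean_space) (\<lambda>r. exp (- t * r powr \<alpha>))"
proof (rule gauss_mixing_lim)
  \<comment> \<open>At this scale (s r)^\<alpha> = t r^\<alpha>/(n+1), so the base is 1 - t
    r^\<alpha>/(n+1) to leading order and its power n+1 tends to exp (-t r^\<alpha>).\<close>
  define s where "s n = (t / real (Suc n)) powr (1 / \<alpha>)" for n
  have s: "s n > 0" for n using t by (simp add: s_def)
  show "gauss_mixing TYPE('a) (\<lambda>r. (1 - (1 - exp (- s n * r)) powr \<alpha>) ^ Suc n)" for n
    by (rule gauss_mixing_sibuya_power[OF \<alpha> s])
  show "\<bar>(1 - (1 - exp (- s n * r)) powr \<alpha>) ^ Suc n\<bar> \<le> 1" if r: "r > 0" for n r
  proof -
    have "0 \<le> 1 - (1 - exp (- s n * r)) powr \<alpha>" "1 - (1 - exp (- s n * r)) powr \<alpha> \<le> 1"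
      using r s[of n] \<alpha> by (auto intro!: powr_le1)
    then show ?thesis by (simp only: power_abs abs_of_nonneg power_le_one)
  qed
  show "(\<lambda>n. (1 - (1 - exp (- s n * r)) powr \<alpha>) ^ Suc n) \<longlonglongrightarrow> exp (- t * r powr \<alpha>)" if r: "r > 0" for r
  proof -
    have "(\<lambda>n. (1 - (1 - exp (- s n * r)) powr \<alpha>) ^ Suc n) \<longlonglongrightarrow> exp (- ((t powr (1 / \<alpha>) * r) powr \<alpha>))"
      unfolding s_def using r \<alpha>(1) t by real_asymp
    then show ?thesis using r \<alpha>(1) t by (simp add: powr_mult powr_powr)
  qed
qed measurable

section \<open>The fractional heat kernel\<close>

text \<open>The symbol is even, so a cosine integral suffices; real values and joint measurability
  are then immediate.\<close>

definition heat :: "real \<Rightarrow> 'a::euclidean_space \<Rightarrow> real \<Rightarrow> real" where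
  "heat \<theta> x t = (LINT \<xi>|lborel. exp (- t * norm \<xi> powr \<theta>) * cos (\<xi> \<bullet> x)) / (2 * pi) ^ DIM('a)"

lemma borel_measurable_heat [measurable]: "(\<lambda>(x, t). heat \<theta> x t) \<in> borel_measurable (borel \<Otimes>\<^sub>M borel)"
  unfolding heat_def by measurable

lemma measurable_heat_comp [measurable (raw)]:
  "f \<in> borel_measurable M \<Longrightarrow> g \<in> borel_measurable M \<Longrightarrow> (\<lambda>z. heat \<theta> (f z) (g z)) \<in> borel_measurable M"
  using measurable_compose[OF measurable_Pair borel_measurable_heat, of f M g \<theta>] by simp

context
  fixes \<theta> :: real
  assumes \<theta>: "0 < \<theta>"
begin

lemma integrable_exp_powr:
  "t > 0 \<Longrightarrow> integrable lborel (\<lambda>\<xi>::'a::euclidean_space. exp (- t * norm \<xi> powr \<theta>))"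
  using integrable_moment_exp_powr[OF _ \<theta>, of t 0, where 'a='a] by simp

lemma integrable_exp_powr_trig:
  fixes f :: "real \<Rightarrow> real"
  assumes t: "t > 0" and [measurable]: "f \<in> borel_measurable borel" and f: "\<And>r. \<bar>f r\<bar> \<le> 1"
  shows "integrable lborel (\<lambda>\<xi>::'a::euclidean_space. exp (- t * norm \<xi> powr \<theta>) * f (\<xi> \<bullet> x))"
  by (rule Bochner_Integration.integrable_bound[OF integrable_exp_powr[OF t]])
    (use f in \<open>auto simp: abs_mult intro!: mult_left_le\<close>)

lemma smooth_heat:
  assumes t: "t > 0"
  shows "smooth (\<lambda>x::'a::euclidean_space. heat \<theta> x t)"
  unfolding smooth_def
proof
  fix n
  have "C_k n (\<lambda>x::'a. LINT \<xi>|lborel. (exp (- t * norm \<xi> powr \<theta>) / (2 * pi) ^ DIM('a)) * cos (\<xi> \<bullet> x + 0))"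
  proof (rule C_k_cos_transform)
    show "integrable lborel (\<lambda>\<xi>::'a. norm \<xi> ^ k * (exp (- t * norm \<xi> powr \<theta>) / (2 * pi) ^ DIM('a)))" for k
      using integrable_divide_zero[OF integrable_moment_exp_powr[OF t \<theta>, of k, where 'a='a], of "(2 * pi) ^ DIM('a)"] by simp
  qed measurable
  then show "C_k n (\<lambda>x::'a. heat \<theta> x t)" by (simp add: heat_def)
qed

lemma continuous_on_heat:
  assumes t: "t > 0"
  shows "continuous_on UNIV (\<lambda>x::'a::euclidean_space. heat \<theta> x t)"
  using smooth_heat[OF t] unfolding smooth_def by (metis C_k.simps(1))

text \<open>Here \<theta> \<le> 2 enters, as \<theta>/2 \<le> 1. The property is known with damping
  1/(n+1), and the damping can be removed in the limit because the symbol itself is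
  integrable.\<close>

lemma mixture_like_heat:
  assumes t: "t > 0" and \<theta>2: "\<theta> \<le> 2"
  shows "mixture_like (\<lambda>x::'a::euclidean_space. heat \<theta> x t)"
proof -
  define \<phi> where "\<phi> r = exp (- t * r powr (\<theta> / 2))" for r
  have gm: "gauss_mixing TYPE('a) \<phi>" unfolding \<phi>_def by (rule gauss_mixing_exp_powr) (use \<theta> \<theta>2 t in auto)
  have \<phi>: "\<phi> ((norm \<xi>)\<^sup>2) = exp (- t * norm \<xi> powr \<theta>)" for \<xi> :: 'a
  proof (cases "\<xi> = 0")
    case False
    then have "(norm \<xi>)\<^sup>2 = norm \<xi> powr 2" by (simp add: powr_numeral)
    then have "(norm \<xi>)\<^sup>2 powr (\<theta> / 2) = norm \<xi> powr \<theta>" by (simp only: powr_powr) simp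
    then show ?thesis by (simp add: \<phi>_def)
  qed (simp add: \<phi>_def)
  have "mixture_like (\<lambda>x::'a. LINT \<xi>|lborel. exp (- t * norm \<xi> powr \<theta>) * cos (\<xi> \<bullet> x))"
  proof (rule mixture_like_lim)
    show "mixture_like (\<lambda>x::'a. LINT \<xi>|lborel. exp (- t * norm \<xi> powr \<theta>) * exp (- (1 / real (Suc n)) * (norm \<xi>)\<^sup>2) * cos (\<xi> \<bullet> x))" for n
    proof -
      have "0 < 1 / real (Suc n)" by simp
      then have "mixture_like (\<lambda>x::'a. LINT \<xi>|lborel. \<phi> ((norm \<xi>)\<^sup>2) * exp (- (1 / real (Suc n)) * (norm \<xi>)\<^sup>2) * cos (\<xi> \<bullet> x))"
        using gm unfolding gauss_mixing_def by blast
      then show ?thesis unfolding \<phi> .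
    qed
    show "(\<lambda>n. LINT \<xi>|lborel. exp (- t * norm \<xi> powr \<theta>) * exp (- (1 / real (Suc n)) * (norm \<xi>)\<^sup>2) * cos (\<xi> \<bullet> x))
       \<longlonglongrightarrow> (LINT \<xi>|lborel. exp (- t * norm \<xi> powr \<theta>) * cos (\<xi> \<bullet> x))" for x :: 'a
    proof (rule integral_dominated_convergence)
      show "integrable lborel (\<lambda>\<xi>::'a. exp (- t * norm \<xi> powr \<theta>))" by (rule integrable_exp_powr[OF t])
      have "(\<lambda>n. exp (- t * norm \<xi> powr \<theta>) * exp (- (1 / real (Suc n)) * (norm \<xi>)\<^sup>2) * cos (\<xi> \<bullet> x)) \<longlonglongrightarrow>
         exp (- t * norm \<xi> powr \<theta>) * exp (- 0 * (norm \<xi>)\<^sup>2) * cos (\<xi> \<bullet> x)" for \<xi>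
      proof -
        have "(\<lambda>n. 1 / real (Suc n)) \<longlonglongrightarrow> 0" by real_asymp
        then show ?thesis by (intro tendsto_intros)
      qed
      then show "AE \<xi> in lborel. (\<lambda>n. exp (- t * norm \<xi> powr \<theta>) * exp (- (1 / real (Suc n)) * (norm \<xi>)\<^sup>2) * cos (\<xi> \<bullet> x)) \<longlonglongrightarrow>
         exp (- t * norm \<xi> powr \<theta>) * cos (\<xi> \<bullet> x)" by simp
      show "AE \<xi> in lborel. norm (exp (- t * norm \<xi> powr \<theta>) * exp (- (1 / real (Suc n)) * (norm \<xi>)\<^sup>2) * cos (\<xi> \<bullet> x))
         \<le> exp (- t * norm \<xi> powr \<theta>)" for n
      proof (intro AE_I2)
        fix \<xi> :: 'a
        have "exp (- (1 / real (Suc n)) * (norm \<xi>)\<^sup>2) * \<bar>cos (\<xi> \<bullet> x)\<bar> \<le> 1 * 1" by (intro mult_mono) auto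
        then have "exp (- t * norm \<xi> powr \<theta>) * (exp (- (1 / real (Suc n)) * (norm \<xi>)\<^sup>2) * \<bar>cos (\<xi> \<bullet> x)\<bar>) \<le> exp (- t * norm \<xi> powr \<theta>)"
          by (intro mult_left_le) auto
        then show "norm (exp (- t * norm \<xi> powr \<theta>) * exp (- (1 / real (Suc n)) * (norm \<xi>)\<^sup>2) * cos (\<xi> \<bullet> x))
         \<le> exp (- t * norm \<xi> powr \<theta>)" by (simp add: abs_mult mult.assoc)
      qed
    qed measurable
  qed
  from mixture_like_cmult[OF this, of "1 / (2 * pi) ^ DIM('a)"] show ?thesis by (simp add: heat_def)
qed

lemma heat_0_pos:
  assumes t: "t > 0"
  shows "heat \<theta> (0::'a::euclidean_space) t > 0"
proof -
  \<comment> \<open>A vanishing integral would force a positive function to be 0 almost everywhere,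
    which a nonzero measure excludes.\<close>
  have "(LINT \<xi>|lborel. exp (- t * norm (\<xi>::'a) powr \<theta>)) \<noteq> 0"
    by (subst integral_nonneg_eq_0_iff_AE[OF integrable_exp_powr[OF t]])
      (auto simp: ae_filter_eq_bot_iff simp flip: trivial_limit_def)
  moreover have "(LINT \<xi>|lborel. exp (- t * norm (\<xi>::'a) powr \<theta>)) \<ge> 0"
    by (rule Bochner_Integration.integral_nonneg) simp
  ultimately have "(LINT \<xi>|lborel. exp (- t * norm (\<xi>::'a) powr \<theta>)) > 0" by (metis order_le_less)
  then show ?thesis by (simp add: heat_def)
qed

lemma heat_pos:
  assumes t: "t > 0" and \<theta>2: "\<theta> \<le> 2"
  shows "heat \<theta> (x::'a::euclidean_space) t > 0"
  by (rule mixture_like_pos[OF mixture_like_heat[OF assms]])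
    (use continuous_on_heat[OF t] heat_0_pos[OF t] in \<open>auto simp: continuous_on_eq_continuous_at\<close>)

lemma heat_antimono:
  assumes "t > 0" "\<theta> \<le> 2" "norm (x::'a) \<le> norm (y::'a)"
  shows "heat \<theta> y t \<le> heat \<theta> (x::'a::euclidean_space) t"
  using mixture_like_heat[OF assms(1,2), where 'a='a] assms(3) unfolding mixture_like_def by blast

text \<open>Substitution of t^(1/\<theta>) \<xi> for \<xi>. By radial monotonicity the value at the
  origin is the maximum of the kernel, so this is its uniform decay rate.\<close>

lemma heat_0_scale:
  assumes t: "t > 0"
  shows "heat \<theta> (0::'a::euclidean_space) t = t powr (- real DIM('a) / \<theta>) * heat \<theta> (0::'a) 1"
proof -
  define c where "c = t powr (1 / \<theta>)"
  have c: "c > 0" using t by (simp add: c_def)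
  have "(LINT \<xi>|lborel. exp (- (norm (\<xi>::'a) powr \<theta>))) = \<bar>c\<bar> ^ DIM('a) *\<^sub>R (LINT \<xi>|lborel. exp (- (norm (0 + c *\<^sub>R (\<xi>::'a)) powr \<theta>)))"
    using c by (intro integral_lborel_affine) auto
  also have "(\<lambda>\<xi>::'a. exp (- (norm (0 + c *\<^sub>R \<xi>) powr \<theta>))) = (\<lambda>\<xi>. exp (- t * norm \<xi> powr \<theta>))"
    using c t \<theta> by (simp add: powr_mult) (simp add: c_def powr_powr)
  also have "\<bar>c\<bar> ^ DIM('a) = t powr (real DIM('a) / \<theta>)"
    using c t by (simp add: c_def powr_powr flip: powr_realpow)
  finally show ?thesis using t by (simp add: heat_def powr_minus field_simps)
qed

text \<open>The sine part vanishes under the reflection \<xi> to -\<xi>.\<close>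

lemma fourier_exp_powr:
  assumes t: "t > 0"
  shows "fourier (\<lambda>\<xi>. complex_of_real (exp (- t * norm \<xi> powr \<theta>))) (x::'a::euclidean_space)
    = complex_of_real ((2 * pi) ^ DIM('a) * heat \<theta> x t)"
proof -
  have "(LINT \<xi>|lborel. exp (- t * norm \<xi> powr \<theta>) * sin (\<xi> \<bullet> x))
      = \<bar>- 1\<bar> ^ DIM('a) *\<^sub>R (LINT \<xi>|lborel. exp (- t * norm (0 + (- 1) *\<^sub>R \<xi>) powr \<theta>) * sin ((0 + (- 1) *\<^sub>R \<xi>) \<bullet> x))"
    by (rule integral_lborel_affine) auto
  then have sin0: "(LINT \<xi>|lborel. exp (- t * norm \<xi> powr \<theta>) * sin (\<xi> \<bullet> x)) = 0"
    by simp
  have ic: "integrable lborel (\<lambda>\<xi>. exp (- t * norm \<xi> powr \<theta>) * cos (\<xi> \<bullet> x))"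
    and is_: "integrable lborel (\<lambda>\<xi>. exp (- t * norm \<xi> powr \<theta>) * sin (\<xi> \<bullet> x))"
    by (rule integrable_exp_powr_trig[OF t]; simp)+
  have "complex_of_real (exp (- t * norm \<xi> powr \<theta>)) * cis (- (x \<bullet> \<xi>))
      = complex_of_real (exp (- t * norm \<xi> powr \<theta>) * cos (\<xi> \<bullet> x)) - \<i> * complex_of_real (exp (- t * norm \<xi> powr \<theta>) * sin (\<xi> \<bullet> x))" for \<xi>
    by (simp add: complex_eq_iff inner_commute)
  then have "fourier (\<lambda>\<xi>. complex_of_real (exp (- t * norm \<xi> powr \<theta>))) x
     = (LINT \<xi>|lborel. complex_of_real (exp (- t * norm \<xi> powr \<theta>) * cos (\<xi> \<bullet> x)) - \<i> * complex_of_real (exp (- t * norm \<xi> powr \<theta>) * sin (\<xi> \<bullet> x)))"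
    by (simp only: fourier_def)
  also have "\<dots> = complex_of_real (LINT \<xi>|lborel. exp (- t * norm \<xi> powr \<theta>) * cos (\<xi> \<bullet> x))
     - \<i> * complex_of_real (LINT \<xi>|lborel. exp (- t * norm \<xi> powr \<theta>) * sin (\<xi> \<bullet> x))"
    unfolding integral_complex_of_real[symmetric] integral_mult_right_zero[symmetric]
    using ic is_ by (intro Bochner_Integration.integral_diff integrable_mult_right) (simp_all only: complex_of_real_integrable_eq)
  finally show ?thesis unfolding sin0 by (simp add: heat_def)
qed

section \<open>Mass, Fourier transform and uniqueness of the kernel\<close>

context
  fixes t :: real
  assumes t: "t > 0" and \<theta>2: "\<theta> \<le> 2"
begin

text \<open>Inversion cannot be used yet, as it presupposes this. Instead the kernel is tested
  against exp (-s |x|^2): the Gaussian pairing bounds the damped mass by 1 for every s > 0, and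
  nonnegativity lets monotone convergence remove the damping.\<close>

lemma integrable_heat: "integrable lborel (\<lambda>x::'a::euclidean_space. heat \<theta> x t)"
proof -
  have nonneg: "0 \<le> heat \<theta> x t" for x :: 'a using heat_pos[OF t \<theta>2, of x] by simp
  define f where "f n x = heat \<theta> x t * exp (- (1 / real (Suc n)) * (norm x)\<^sup>2)" for n and x :: 'a
  have [measurable]: "f n \<in> borel_measurable borel" for n unfolding f_def by measurable
  have le1: "(\<integral>\<^sup>+x. ennreal (f n x) \<partial>lborel) \<le> 1" for n
  proof -
    define s where "s = 1 / real (Suc n)"
    have s: "s > 0" by (simp add: s_def)
    have fs: "f n x = heat \<theta> x t * exp (- s * (norm x)\<^sup>2)" for x by (simp only: f_def s_def)
    have int: "integrable lborel (f n)"
    proof (rule Bochner_Integration.integrable_bound)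
      show "integrable lborel (\<lambda>x::'a. heat \<theta> (0::'a) t * exp (- s * (norm x)\<^sup>2))"
        using has_bochner_integral_gauss[OF s, where 'a='a] by (auto simp: has_bochner_integral_iff)
      show "AE x in lborel. norm (f n x) \<le> norm (heat \<theta> (0::'a) t * exp (- s * (norm x)\<^sup>2))"
        using nonneg heat_antimono[OF t \<theta>2, of 0] by (auto simp: fs abs_mult)
    qed measurable
    have "complex_of_real ((2 * pi) ^ DIM('a) * (LINT x|lborel. f n x))
       = (LINT \<xi>|lborel. cis (\<xi> \<bullet> 0) * complex_of_real (exp (- s * (norm \<xi>)\<^sup>2)) * fourier (\<lambda>\<xi>::'a. complex_of_real (exp (- t * norm \<xi> powr \<theta>))) \<xi>)"
      unfolding fourier_exp_powr[OF t] by (simp add: fs mult_ac flip: integral_mult_right_zero integral_complex_of_real)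
    also have "\<dots> = (LINT y|lborel. complex_of_real (exp (- t * norm (y::'a) powr \<theta>)) * complex_of_real (sqrt (pi / s) ^ DIM('a) * exp (- (norm (0 - y))\<^sup>2 / (4 * s))))"
      by (intro fourier_gauss_pairing s) (use integrable_exp_powr[OF t] in \<open>simp only: complex_of_real_integrable_eq\<close>)
    also have "\<dots> = complex_of_real (LINT y|lborel. exp (- t * norm (y::'a) powr \<theta>) * (sqrt (pi / s) ^ DIM('a) * exp (- (norm y)\<^sup>2 / (4 * s))))"
      unfolding integral_complex_of_real[symmetric] by simp
    finally have "(2 * pi) ^ DIM('a) * (LINT x|lborel. f n x) = (LINT y|lborel. exp (- t * norm (y::'a) powr \<theta>) * (sqrt (pi / s) ^ DIM('a) * exp (- (norm y)\<^sup>2 / (4 * s))))"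
      unfolding of_real_eq_iff .
    \<comment> \<open>Bounding the symbol by 1 leaves a Gaussian whose integral is (2 pi)^N whatever
      s is, the same factor as on the left.\<close>
    also have "\<dots> \<le> (LINT y|lborel. sqrt (pi / s) ^ DIM('a) * exp (- (1 / (4 * s)) * (norm (y::'a))\<^sup>2))"
    proof (rule integral_mono_AE')
      show "integrable lborel (\<lambda>y::'a. sqrt (pi / s) ^ DIM('a) * exp (- (1 / (4 * s)) * (norm y)\<^sup>2))"
        using has_bochner_integral_gauss[of "1 / (4 * s)", where 'a='a] s by (auto simp: has_bochner_integral_iff)
      show "AE y in lborel. exp (- t * norm (y::'a) powr \<theta>) * (sqrt (pi / s) ^ DIM('a) * exp (- (norm y)\<^sup>2 / (4 * s)))
         \<le> sqrt (pi / s) ^ DIM('a) * exp (- (1 / (4 * s)) * (norm y)\<^sup>2)"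
        using t s by (intro AE_I2) (simp add: mult_left_le_one_le)
      show "AE y in lborel. 0 \<le> sqrt (pi / s) ^ DIM('a) * exp (- (1 / (4 * s)) * (norm (y::'a))\<^sup>2)" using s by simp
    qed
    also have "\<dots> = sqrt (pi / s) ^ DIM('a) * sqrt (pi / (1 / (4 * s))) ^ DIM('a)"
      using has_bochner_integral_gauss[of "1 / (4 * s)", where 'a='a] s by (simp add: has_bochner_integral_iff)
    also have "\<dots> = (2 * pi) ^ DIM('a)"
      unfolding power_mult_distrib[symmetric] real_sqrt_mult[symmetric] using s
      by (intro arg_cong[of _ _ "\<lambda>x. x ^ DIM('a)"] real_sqrt_unique) (auto simp: power2_eq_square)
    finally have "(LINT x|lborel. f n x) \<le> 1" by (simp del: fs)
    moreover have "AE x in lborel. 0 \<le> f n x" using nonneg by (simp add: f_def)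
    ultimately show ?thesis by (simp only: nn_integral_eq_integral[OF int] ennreal_le_1)
  qed
  have "(\<lambda>n. \<integral>\<^sup>+x. ennreal (f n x) \<partial>lborel) \<longlonglongrightarrow> (\<integral>\<^sup>+x. ennreal (heat \<theta> (x::'a) t) \<partial>lborel)"
  proof (rule nn_integral_LIMSEQ)
    show "incseq (\<lambda>n x. ennreal (f n x))"
      unfolding incseq_def le_fun_def f_def using nonneg
      by (auto intro!: ennreal_leI mult_left_mono mult_right_mono frac_le)
    have "(\<lambda>n. f n x) \<longlonglongrightarrow> heat \<theta> x t * exp (- 0 * (norm x)\<^sup>2)" for x
    proof -
      have "(\<lambda>n. 1 / real (Suc n)) \<longlonglongrightarrow> 0" by real_asymp
      then show ?thesis unfolding f_def by (intro tendsto_intros)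
    qed
    then show "(\<lambda>n. ennreal (f n x)) \<longlonglongrightarrow> ennreal (heat \<theta> x t)" for x
      by (intro tendsto_ennrealI) simp
  qed measurable
  then have "(\<integral>\<^sup>+x. ennreal (heat \<theta> (x::'a) t) \<partial>lborel) \<le> 1"
    using le1 by (intro LIMSEQ_le_const2) auto
  then show ?thesis
    using nonneg by (intro integrableI_nonneg) (auto simp: order_le_less_trans[OF _ ennreal_one_less_top])
qed

text \<open>Inversion is applied to the symbol, whose transform is (2 pi)^N times the kernel and is
  now known to be integrable.\<close>

lemma integral_heat_cis:
  "(LINT y|lborel. complex_of_real (heat \<theta> y t) * cis (y \<bullet> x)) = complex_of_real (exp (- t * norm (x::'a::euclidean_space) powr \<theta>))"
proof -
  let ?\<phi> = "\<lambda>\<xi>::'a. complex_of_real (exp (- t * norm \<xi> powr \<theta>))"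
  have f: "fourier ?\<phi> = (\<lambda>x. complex_of_real ((2 * pi) ^ DIM('a) * heat \<theta> x t))"
    by (rule ext) (rule fourier_exp_powr[OF t])
  have "(LINT y|lborel. fourier ?\<phi> y * cis (y \<bullet> x)) = (2 * pi) ^ DIM('a) * ?\<phi> x"
  proof (rule fourier_inversion)
    show "integrable lborel ?\<phi>" using integrable_exp_powr[OF t] by (simp only: complex_of_real_integrable_eq)
    show "integrable lborel (fourier ?\<phi>)" unfolding f complex_of_real_integrable_eq using integrable_heat by simp
    have "continuous_on UNIV (\<lambda>\<xi>::'a. norm \<xi> powr \<theta>)"
      using \<theta> by (intro continuous_on_powr') (auto intro: continuous_intros)
    then show "continuous_on UNIV ?\<phi>"
      by (intro continuous_on_of_real continuous_on_exp continuous_on_mult continuous_on_const)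
  qed
  then have "(2 * pi) ^ DIM('a) * (LINT y|lborel. complex_of_real (heat \<theta> y t) * cis (y \<bullet> x)) = (2 * pi) ^ DIM('a) * ?\<phi> x"
    unfolding f by (simp add: mult.assoc)
  then show ?thesis by simp
qed

text \<open>\<open>heat\<close> has all the listed properties. Conversely any g with them is
  continuous and integrable with an integrable transform, so inversion recovers g from the
  symbol.\<close>

lemma frac_heat_kernel_eq: "frac_heat_kernel \<theta> (x::'a::euclidean_space) t = heat \<theta> x t"
proof -
  have cis: "exp (- (\<i> * complex_of_real r)) = cis (- r)" for r by (simp add: cis_conv_exp)
  have "(THE g. smooth g \<and> (\<forall>y. g y > 0) \<and> integrable lborel g \<and>
        (\<forall>\<xi>::'a. (LINT y|lborel. complex_of_real (g y) * exp (- (\<i> * complex_of_real (\<xi> \<bullet> y))))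
              = complex_of_real (exp (- t * norm \<xi> powr \<theta>)))) = (\<lambda>x. heat \<theta> x t)"
  proof (rule the_equality, intro conjI allI)
    show "smooth (\<lambda>x::'a. heat \<theta> x t)" by (rule smooth_heat[OF t])
    show "heat \<theta> y t > 0" for y :: 'a by (rule heat_pos[OF t \<theta>2])
    show "integrable lborel (\<lambda>x::'a. heat \<theta> x t)" by (rule integrable_heat)
    show "(LINT y|lborel. complex_of_real (heat \<theta> y t) * exp (- (\<i> * complex_of_real (\<xi> \<bullet> y))))
              = complex_of_real (exp (- t * norm \<xi> powr \<theta>))" for \<xi> :: 'a
      using integral_heat_cis[of "- \<xi>"] unfolding cis by (simp add: inner_commute)
  next
    fix g :: "'a \<Rightarrow> real"
    assume g: "smooth g \<and> (\<forall>y. g y > 0) \<and> integrable lborel g \<and>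
        (\<forall>\<xi>. (LINT y|lborel. complex_of_real (g y) * exp (- (\<i> * complex_of_real (\<xi> \<bullet> y))))
              = complex_of_real (exp (- t * norm \<xi> powr \<theta>)))"
    then have F: "fourier (\<lambda>y. complex_of_real (g y)) = (\<lambda>\<xi>. complex_of_real (exp (- t * norm \<xi> powr \<theta>)))"
      unfolding fourier_def cis by blast
    have "continuous_on UNIV g" using g unfolding smooth_def by (metis C_k.simps(1))
    then have inv: "(LINT \<xi>|lborel. fourier (\<lambda>y. complex_of_real (g y)) \<xi> * cis (\<xi> \<bullet> x)) = (2 * pi) ^ DIM('a) * complex_of_real (g x)" for x
      by (intro fourier_inversion)
        (use g integrable_exp_powr[OF t, where 'a='a] in \<open>auto simp only: F complex_of_real_integrable_eq intro!: continuous_intros\<close>)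
    show "g = (\<lambda>x. heat \<theta> x t)"
    proof
      fix x
      \<comment> \<open>The inversion integral carries the opposite sign in the character, hence the
        argument -x; the kernel is even.\<close>
      have "(2 * pi) ^ DIM('a) * complex_of_real (g x) = fourier (\<lambda>\<xi>. complex_of_real (exp (- t * norm \<xi> powr \<theta>))) (- x)"
        unfolding inv[symmetric] F by (simp add: fourier_def inner_commute)
      also have "\<dots> = (2 * pi) ^ DIM('a) * complex_of_real (heat \<theta> (- x) t)"
        unfolding fourier_exp_powr[OF t] by simp
      finally have "complex_of_real (g x) = complex_of_real (heat \<theta> (- x) t)" by simp
      then have "g x = heat \<theta> (- x) t" by (simp only: of_real_eq_iff)
      then show "g x = heat \<theta> x t" by (simp add: heat_def)
    qed
  qed
  then show ?thesis unfolding frac_heat_kernel_def by simp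
qed

lemma nn_integral_heat: "(\<integral>\<^sup>+x. ennreal (heat \<theta> (x::'a::euclidean_space) t) \<partial>lborel) = 1"
proof -
  have "complex_of_real (LINT y|lborel. heat \<theta> (y::'a) t) = 1"
    using integral_heat_cis[of "0::'a"] \<theta> by simp
  then show ?thesis
    using integrable_heat less_imp_le[OF heat_pos[OF t \<theta>2]] by (subst nn_integral_eq_integral) auto
qed

end

text \<open>The second kernel is written as the transform of its symbol and the multiplication
  formula moves that transform onto the first. The symbols multiply to the one at time t + s, whose
  transform is the right side.\<close>

lemma heat_convolution:
  assumes t: "t > 0" and s: "s > 0" and \<theta>2: "\<theta> \<le> 2"
  shows "(\<integral>\<^sup>+z. ennreal (heat \<theta> (x - z) t) * ennreal (heat \<theta> z s) \<partial>lborel) = ennreal (heat \<theta> (x::'a::euclidean_space) (t + s))"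
proof -
  let ?\<phi> = "\<lambda>t \<xi>::'a. complex_of_real (exp (- t * norm \<xi> powr \<theta>))"
  have it: "integrable lborel (\<lambda>z. heat \<theta> (x - z) t)"
    using integrable_lborel_affine_iff[of "-1" "\<lambda>z. heat \<theta> z t" x] integrable_heat[OF t \<theta>2, where 'a='a] by simp
  have is_: "integrable lborel (\<lambda>z::'a. heat \<theta> z s)" by (rule integrable_heat[OF s \<theta>2])
  have nonneg: "0 \<le> heat \<theta> z t" "0 \<le> heat \<theta> z s" for z :: 'a using heat_pos[OF t \<theta>2, of z] heat_pos[OF s \<theta>2, of z] by auto
  have inner: "(LINT z|lborel. complex_of_real (heat \<theta> (x - z) t) * cis (- (z \<bullet> \<xi>))) = cis (- (x \<bullet> \<xi>)) * ?\<phi> t \<xi>" for \<xi>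
  proof -
    have "(LINT z|lborel. complex_of_real (heat \<theta> (x - z) t) * cis (- (z \<bullet> \<xi>)))
       = \<bar>- 1\<bar> ^ DIM('a) *\<^sub>R (LINT z|lborel. complex_of_real (heat \<theta> (x - (x + (- 1) *\<^sub>R z)) t) * cis (- ((x + (- 1) *\<^sub>R z) \<bullet> \<xi>)))"
      by (rule integral_lborel_affine) auto
    also have "(\<lambda>z. complex_of_real (heat \<theta> (x - (x + (- 1) *\<^sub>R z)) t) * cis (- ((x + (- 1) *\<^sub>R z) \<bullet> \<xi>)))
       = (\<lambda>z. cis (- (x \<bullet> \<xi>)) * (complex_of_real (heat \<theta> z t) * cis (z \<bullet> \<xi>)))"
    proof
      fix z
      have "cis (- ((x + (- 1) *\<^sub>R z) \<bullet> \<xi>)) = cis (- (x \<bullet> \<xi>)) * cis (z \<bullet> \<xi>)"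
        by (simp add: inner_diff_left cis_mult)
      then show "complex_of_real (heat \<theta> (x - (x + (- 1) *\<^sub>R z)) t) * cis (- ((x + (- 1) *\<^sub>R z) \<bullet> \<xi>))
         = cis (- (x \<bullet> \<xi>)) * (complex_of_real (heat \<theta> z t) * cis (z \<bullet> \<xi>))"
        by (simp del: inner_add_left)
    qed
    also have "\<bar>- 1\<bar> ^ DIM('a) *\<^sub>R (LINT z|lborel. cis (- (x \<bullet> \<xi>)) * (complex_of_real (heat \<theta> z t) * cis (z \<bullet> \<xi>))) = cis (- (x \<bullet> \<xi>)) * ?\<phi> t \<xi>"
      unfolding integral_mult_right_zero integral_heat_cis[OF t \<theta>2] by simp
    finally show ?thesis .
  qed
  have "(LINT z|lborel. complex_of_real (heat \<theta> (x - z) t) * fourier (?\<phi> s) z)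
     = (LINT \<xi>|lborel. ?\<phi> s \<xi> * (LINT z|lborel. complex_of_real (heat \<theta> (x - z) t) * cis (- (z \<bullet> \<xi>))))"
    unfolding fourier_def
    by (rule integral_tensor_swap) (use it integrable_exp_powr[OF s, where 'a='a] in \<open>simp_all only: complex_of_real_integrable_eq norm_cis, measurable\<close>)
  also have "\<dots> = fourier (?\<phi> (t + s)) x"
    unfolding inner fourier_def by (simp add: mult_ac distrib_right exp_diff exp_minus exp_add field_simps)
  finally have "(2 * pi) ^ DIM('a) * complex_of_real (LINT z|lborel. heat \<theta> (x - z) t * heat \<theta> z s) = (2 * pi) ^ DIM('a) * complex_of_real (heat \<theta> x (t + s))"
    using t s unfolding fourier_exp_powr[OF s] fourier_exp_powr[OF add_pos_pos[OF t s]]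
    by (simp add: mult_ac flip: integral_complex_of_real integral_mult_right_zero)
  then have eq: "(LINT z|lborel. heat \<theta> (x - z) t * heat \<theta> z s) = heat \<theta> x (t + s)" by (simp only: mult_cancel_left of_real_eq_iff) simp
  have "integrable lborel (\<lambda>z. heat \<theta> (x - z) t * heat \<theta> z s)"
  proof (rule Bochner_Integration.integrable_bound)
    show "integrable lborel (\<lambda>z. heat \<theta> (0::'a) t * heat \<theta> (z::'a) s)" using is_ by simp
    show "AE z in lborel. norm (heat \<theta> (x - z) t * heat \<theta> z s) \<le> norm (heat \<theta> (0::'a) t * heat \<theta> z s)"
      using nonneg heat_antimono[OF t \<theta>2, of 0] by (auto simp: abs_mult intro!: mult_right_mono)
  qed measurable
  then show ?thesis
    using nonneg by (simp add: eq nn_integral_eq_integral flip: ennreal_mult)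
qed

end

section \<open>Evolution of Radon measures\<close>

lemma radon_measure_sets: "radon_measure \<mu> \<Longrightarrow> sets \<mu> = sets borel"
  by (simp add: radon_measure_def)

lemma radon_measure_sigma_finite:
  assumes \<mu>: "radon_measure (\<mu> :: 'a::euclidean_space measure)"
  shows "sigma_finite_measure \<mu>"
proof
  have sp: "space \<mu> = UNIV" using sets_eq_imp_space_eq[OF radon_measure_sets[OF \<mu>]] by simp
  have "\<exists>n::nat. x \<in> cball 0 (real n)" for x :: 'a using real_arch_simple[of "norm x"] by auto
  then show "\<exists>A. countable A \<and> A \<subseteq> sets \<mu> \<and> \<Union> A = space \<mu> \<and> (\<forall>a\<in>A. emeasure \<mu> a \<noteq> \<infinity>)"
    using \<mu> sp unfolding radon_measure_def
    by (intro exI[of _ "range (\<lambda>n::nat. cball (0::'a) (real n))"]) (auto simp: less_top[symmetric])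
qed

text \<open>Built on \<open>heat\<close>, which is visibly measurable in space and time jointly; the
  identification with \<open>frac_heat_kernel\<close> is made at positive times.\<close>

definition heat_evolution :: "real \<Rightarrow> 'a::euclidean_space measure \<Rightarrow> 'a \<Rightarrow> real \<Rightarrow> ennreal" where
  "heat_evolution \<theta> \<mu> x t = (\<integral>\<^sup>+ y. ennreal (heat \<theta> (x - y) t) \<partial>\<mu>)"

lemma heat_evolution_measurable:
  assumes \<mu>: "radon_measure \<mu>"
  shows "(\<lambda>(x, t). heat_evolution \<theta> \<mu> x t) \<in> borel_measurable (borel \<Otimes>\<^sub>M borel)"
proof -
  interpret sigma_finite_measure \<mu> by (rule radon_measure_sigma_finite[OF \<mu>])
  have [measurable_cong]: "sets \<mu> = sets borel" by (rule radon_measure_sets[OF \<mu>])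
  show ?thesis unfolding heat_evolution_def by measurable
qed

text \<open>The first summand is the maximum of the kernel at time 1, for the ball around the
  origin; the second is the inverse volume of a ball of radius 1/2, from averaging
  elsewhere.\<close>

definition heat_bound :: "real \<Rightarrow> 'a::euclidean_space itself \<Rightarrow> real" where
  "heat_bound \<theta> _ = heat \<theta> (0::'a) 1 + 2 ^ DIM('a) / measure lborel (ball (0::'a) 1)"

context
  fixes \<theta> :: real
  assumes \<theta>: "0 < \<theta>" and \<theta>2: "\<theta> \<le> 2"
begin

lemma heat_bound_pos: "heat_bound \<theta> TYPE('a::euclidean_space) > 0"
  unfolding heat_bound_def using heat_0_pos[OF \<theta>, of 1, where 'a='a] content_ball_pos[of 1 "0::'a"]
  by (intro add_pos_pos) auto

text \<open>A radially nonincreasing kernel is dominated, away from the origin, by its averages over balls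
  that are shifted towards the origin.\<close>

lemma heat_le_average:
  fixes y :: "'a::euclidean_space"
  assumes t: "t > 0" and r: "r > 0"
  shows "ennreal (heat \<theta> y t) \<le> ennreal (heat \<theta> (0::'a) t) * indicator (ball 0 r) y +
    ennreal (1 / measure lborel (ball (0::'a) (r / 2))) * (\<integral>\<^sup>+ w. ennreal (heat \<theta> w t) * indicator (ball y r) w \<partial>lborel)"
proof (cases "norm y < r")
  case True
  then have "ennreal (heat \<theta> y t) \<le> ennreal (heat \<theta> (0::'a) t) * indicator (ball 0 r) y"
    using heat_antimono[OF \<theta> t \<theta>2, of 0 y] by (auto intro: ennreal_leI)
  then show ?thesis by (rule order_trans) simp
next
  case False
  define V where "V = measure lborel (ball (0::'a) (r / 2))"
  \<comment> \<open>The point y moved by r/2 towards the origin: the ball of radius r/2 around c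
    lies inside the ball of radius r around y, and its points have norm at most |y|.\<close>
  define c where "c = (1 - r / (2 * norm y)) *\<^sub>R y"
  have y: "norm y \<ge> r" "norm y > 0" using False r by auto
  have "r / (2 * norm y) \<le> 1" using y r by simp
  then have nc: "norm c = norm y - r / 2" using y by (simp add: c_def left_diff_distrib)
  have "y - c = (r / (2 * norm y)) *\<^sub>R y" by (simp add: c_def algebra_simps)
  then have dc: "norm (y - c) = r / 2" using y r by simp
  have V: "V > 0" unfolding V_def using r by (intro content_ball_pos) simp
  have Vc: "emeasure lborel (ball c (r / 2)) = ennreal V"
  proof -
    have "emeasure lborel (ball c (r / 2)) = ennreal (measure lborel (ball c (r / 2)))"
      using emeasure_lborel_ball_finite[of c "r / 2"] by (intro emeasure_eq_ennreal_measure) (auto simp: less_top)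
    then show ?thesis
      using content_ball_conv_unit_ball[of "r / 2" c] content_ball_conv_unit_ball[of "r / 2" "0::'a"] r by (simp add: V_def)
  qed
  have "ennreal (heat \<theta> y t) = ennreal (1 / V) * (ennreal (heat \<theta> y t) * ennreal V)"
    using V heat_pos[OF \<theta> t \<theta>2, of y] by (simp flip: ennreal_mult)
  also have "ennreal (heat \<theta> y t) * ennreal V = (\<integral>\<^sup>+ w. ennreal (heat \<theta> y t) * indicator (ball c (r / 2)) w \<partial>lborel)"
    by (subst nn_integral_cmult_indicator) (simp_all add: Vc)
  also have "\<dots> \<le> (\<integral>\<^sup>+ w. ennreal (heat \<theta> w t) * indicator (ball y r) w \<partial>lborel)"
  proof (rule nn_integral_mono)
    fix w
    show "ennreal (heat \<theta> y t) * indicator (ball c (r / 2)) w \<le> ennreal (heat \<theta> w t) * indicator (ball y r) w"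
    proof (cases "w \<in> ball c (r / 2)")
      case True
      then have wc: "norm (w - c) < r / 2" by (simp add: dist_norm norm_minus_commute)
      have "norm w \<le> norm y" using norm_triangle_ineq[of "w - c" c] wc nc by simp
      moreover have "norm (y - w) < r" using norm_triangle_ineq4[of "y - c" "w - c"] wc dc by simp
      ultimately show ?thesis
        using heat_antimono[OF \<theta> t \<theta>2, of w y] True by (simp add: dist_norm ennreal_leI)
    qed simp
  qed
  finally have "ennreal (heat \<theta> y t) \<le> ennreal (1 / V) * (\<integral>\<^sup>+ w. ennreal (heat \<theta> w t) * indicator (ball y r) w \<partial>lborel)"
    by (simp add: mult_left_mono)
  then show ?thesis unfolding V_def by (rule order_trans) simp
qed

text \<open>Bounding the kernel by averages and applying Fubini, each w contributes the measure of
  one ball of radius r = t^(1/\<theta>), weighted by the kernel, whose total mass is 1.\<close>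

lemma heat_evolution_le:
  fixes \<mu> :: "'a::euclidean_space measure"
  assumes \<mu>: "radon_measure \<mu>" and t: "t > 0"
  shows "heat_evolution \<theta> \<mu> x t \<le> ennreal (heat_bound \<theta> TYPE('a) * t powr (- real DIM('a) / \<theta>))
    * (SUP x. emeasure \<mu> (ball x (t powr (1 / \<theta>))))"
proof -
  interpret \<mu>: sigma_finite_measure \<mu> by (rule radon_measure_sigma_finite[OF \<mu>])
  interpret P: pair_sigma_finite \<mu> lborel ..
  have [measurable_cong]: "sets \<mu> = sets borel" by (rule radon_measure_sets[OF \<mu>])
  have sp: "space \<mu> = UNIV" using sets_eq_imp_space_eq[OF radon_measure_sets[OF \<mu>]] by simp
  define r where "r = t powr (1 / \<theta>)"
  define S where "S = (SUP x. emeasure \<mu> (ball x r))"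
  define V where "V = measure lborel (ball (0::'a) (r / 2))"
  have r: "r > 0" using t by (simp add: r_def)
  have S: "emeasure \<mu> (ball x r) \<le> S" for x unfolding S_def by (intro SUP_upper) simp
  \<comment> \<open>Exchanging the roles of w and y makes the integral over y the measure of a ball
    around x - w.\<close>
  have ball: "indicator (ball (x - y) r) w = (indicator (ball (x - w) r) y :: ennreal)" for w y
    by (simp add: indicator_def dist_norm) (metis diff_diff_eq2 add.commute diff_diff_eq norm_minus_commute)
  have avg: "(\<integral>\<^sup>+ w. ennreal (heat \<theta> w t) * indicator (ball (x - y) r) w \<partial>lborel)
    = (\<integral>\<^sup>+ w. ennreal (heat \<theta> w t) * indicator (ball (x - w) r) y \<partial>lborel)" for y
    by (intro nn_integral_cong) (subst ball, rule refl)
  have ball0: "indicator (ball 0 r) (x - y) = (indicator (ball x r) y :: ennreal)" for y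
    by (simp add: indicator_def dist_norm norm_minus_commute)
  have [measurable]: "ball z r \<in> sets \<mu>" for z by (simp add: radon_measure_sets[OF \<mu>])
  have [measurable]: "(\<lambda>(y, w). ennreal (heat \<theta> w t) * indicator (ball (x - w) r) y) \<in> borel_measurable (\<mu> \<Otimes>\<^sub>M lborel)"
    unfolding indicator_def mem_ball by measurable
  have "heat_evolution \<theta> \<mu> x t \<le> (\<integral>\<^sup>+ y. ennreal (heat \<theta> (0::'a) t) * indicator (ball 0 r) (x - y) +
    ennreal (1 / V) * (\<integral>\<^sup>+ w. ennreal (heat \<theta> w t) * indicator (ball (x - y) r) w \<partial>lborel) \<partial>\<mu>)"
    unfolding heat_evolution_def V_def by (intro nn_integral_mono heat_le_average t r)
  also have "\<dots> = (\<integral>\<^sup>+ y. ennreal (heat \<theta> (0::'a) t) * indicator (ball x r) y +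
    ennreal (1 / V) * (\<integral>\<^sup>+ w. ennreal (heat \<theta> w t) * indicator (ball (x - w) r) y \<partial>lborel) \<partial>\<mu>)"
    unfolding avg ball0 ..
  also have "\<dots> = ennreal (heat \<theta> (0::'a) t) * emeasure \<mu> (ball x r) +
    ennreal (1 / V) * (\<integral>\<^sup>+ y. \<integral>\<^sup>+ w. ennreal (heat \<theta> w t) * indicator (ball (x - w) r) y \<partial>lborel \<partial>\<mu>)"
    by (subst nn_integral_add) (auto simp: nn_integral_cmult)
  also have "(\<integral>\<^sup>+ y. \<integral>\<^sup>+ w. ennreal (heat \<theta> w t) * indicator (ball (x - w) r) y \<partial>lborel \<partial>\<mu>)
    = (\<integral>\<^sup>+ w. \<integral>\<^sup>+ y. ennreal (heat \<theta> w t) * indicator (ball (x - w) r) y \<partial>\<mu> \<partial>lborel)"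
    by (rule P.Fubini'[symmetric]) measurable
  also have "\<dots> = (\<integral>\<^sup>+ w. ennreal (heat \<theta> w t) * emeasure \<mu> (ball (x - w) r) \<partial>lborel)"
    by (simp add: nn_integral_cmult)
  also have "\<dots> \<le> (\<integral>\<^sup>+ w. ennreal (heat \<theta> (w::'a) t) * S \<partial>lborel)"
    by (intro nn_integral_mono mult_left_mono S) simp
  also have "\<dots> = S" by (simp add: nn_integral_multc nn_integral_heat[OF \<theta> t \<theta>2])
  finally have "heat_evolution \<theta> \<mu> x t \<le> ennreal (heat \<theta> (0::'a) t) * emeasure \<mu> (ball x r) + ennreal (1 / V) * S"
    by (simp add: add_left_mono mult_left_mono)
  also have "\<dots> \<le> ennreal (heat \<theta> (0::'a) t) * S + ennreal (1 / V) * S"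
    by (intro add_right_mono mult_left_mono S) simp
  also have "\<dots> = ennreal (heat \<theta> (0::'a) t + 1 / V) * S"
    using heat_0_pos[OF \<theta> t, where 'a='a] by (simp add: V_def distrib_right)
  also have "heat \<theta> (0::'a) t + 1 / V = heat_bound \<theta> TYPE('a) * t powr (- real DIM('a) / \<theta>)"
  proof -
    have "V = (r / 2) ^ DIM('a) * measure lborel (ball (0::'a) 1)"
      unfolding V_def using r by (intro content_ball_conv_unit_ball) simp
    moreover have "r ^ DIM('a) = t powr (real DIM('a) / \<theta>)"
      using t by (simp add: r_def powr_powr flip: powr_realpow)
    ultimately have "V = t powr (real DIM('a) / \<theta>) / 2 ^ DIM('a) * measure lborel (ball (0::'a) 1)"
      by (simp add: power_divide)
    moreover have "V > 0" unfolding V_def using r by (intro content_ball_pos) simp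
    ultimately have "1 / V = (2 ^ DIM('a) / measure lborel (ball (0::'a) 1)) * t powr (- real DIM('a) / \<theta>)"
      using t by (simp add: powr_minus divide_simps mult.commute)
    then show ?thesis unfolding heat_bound_def heat_0_scale[OF \<theta> t, where 'a='a] by (simp add: algebra_simps)
  qed
  finally show ?thesis unfolding S_def r_def .
qed

text \<open>Fubini leaves, for each z, a convolution of two kernels; translating by z reduces it to
  \<open>heat_convolution\<close>.\<close>

lemma heat_evolution_semigroup:
  fixes \<mu> :: "'a::euclidean_space measure"
  assumes \<mu>: "radon_measure \<mu>" and s: "0 < s" "s < t"
  shows "(\<integral>\<^sup>+ y. ennreal (heat \<theta> (x - y) (t - s)) * heat_evolution \<theta> \<mu> y s \<partial>lborel) = heat_evolution \<theta> \<mu> x t"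
proof -
  interpret \<mu>: sigma_finite_measure \<mu> by (rule radon_measure_sigma_finite[OF \<mu>])
  interpret P: pair_sigma_finite \<mu> lborel ..
  have [measurable_cong]: "sets \<mu> = sets borel" by (rule radon_measure_sets[OF \<mu>])
  have "(\<integral>\<^sup>+ y. ennreal (heat \<theta> (x - y) (t - s)) * heat_evolution \<theta> \<mu> y s \<partial>lborel)
     = (\<integral>\<^sup>+ y. \<integral>\<^sup>+ z. ennreal (heat \<theta> (x - y) (t - s)) * ennreal (heat \<theta> (y - z) s) \<partial>\<mu> \<partial>lborel)"
    unfolding heat_evolution_def by (simp add: nn_integral_cmult)
  also have "\<dots> = (\<integral>\<^sup>+ z. \<integral>\<^sup>+ y. ennreal (heat \<theta> (x - y) (t - s)) * ennreal (heat \<theta> (y - z) s) \<partial>lborel \<partial>\<mu>)"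
    by (rule P.Fubini') measurable
  also have "\<dots> = (\<integral>\<^sup>+ z. ennreal (heat \<theta> (x - z) t) \<partial>\<mu>)"
  proof (rule nn_integral_cong)
    fix z
    have "(\<integral>\<^sup>+ y. ennreal (heat \<theta> (x - y) (t - s)) * ennreal (heat \<theta> (y - z) s) \<partial>lborel)
       = ennreal (\<bar>1\<bar> ^ DIM('a)) * (\<integral>\<^sup>+ y. ennreal (heat \<theta> (x - (z + 1 *\<^sub>R y)) (t - s)) * ennreal (heat \<theta> (z + 1 *\<^sub>R y - z) s) \<partial>lborel)"
      by (rule nn_integral_lborel_affine) auto
    also have "\<dots> = (\<integral>\<^sup>+ y. ennreal (heat \<theta> (x - z - y) (t - s)) * ennreal (heat \<theta> y s) \<partial>lborel)"
      by (simp add: diff_diff_eq)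
    also have "\<dots> = ennreal (heat \<theta> (x - z) t)"
      using heat_convolution[OF \<theta> _ s(1) \<theta>2, of "t - s" "x - z"] s by simp
    finally show "(\<integral>\<^sup>+ y. ennreal (heat \<theta> (x - y) (t - s)) * ennreal (heat \<theta> (y - z) s) \<partial>lborel) = ennreal (heat \<theta> (x - z) t)" .
  qed
  finally show ?thesis by (simp add: heat_evolution_def)
qed

end

section \<open>Monotone iteration\<close>

lemma ennreal_powr_mono: "a \<le> b \<Longrightarrow> 0 \<le> p \<Longrightarrow> ennreal_powr a p \<le> ennreal_powr b p"
  unfolding ennreal_powr_def
  by (auto simp: top_unique less_top intro!: ennreal_leI powr_mono2 enn2real_mono)

lemma measurable_ennreal_powr [measurable (raw)]:
  assumes [measurable]: "f \<in> borel_measurable M"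
  shows "(\<lambda>x. ennreal_powr (f x) p) \<in> borel_measurable M"
  unfolding ennreal_powr_def by measurable

lemma ennreal_powr_tendsto:
  assumes f: "(f \<longlongrightarrow> l) F" and l: "l < \<infinity>" and p: "p > 0"
  shows "((\<lambda>n. ennreal_powr (f n) p) \<longlongrightarrow> ennreal_powr l p) F"
proof -
  have "eventually (\<lambda>n. f n < \<infinity>) F" using f l by (rule order_tendstoD)
  then have ev: "eventually (\<lambda>n. ennreal (enn2real (f n) powr p) = ennreal_powr (f n) p) F"
    by eventually_elim (simp add: ennreal_powr_def)
  have "((\<lambda>n. enn2real (f n)) \<longlongrightarrow> enn2real l) F"
    using f l by (intro tendsto_enn2real) (auto simp: ennreal_enn2real_if)
  then have "((\<lambda>n. enn2real (f n) powr p) \<longlongrightarrow> enn2real l powr p) F"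
    using p by (intro tendsto_powr') auto
  then have "((\<lambda>n. ennreal (enn2real (f n) powr p)) \<longlongrightarrow> ennreal_powr l p) F"
    using l by (auto simp: ennreal_powr_def)
  then show ?thesis using ev by (rule Lim_transform_eventually)
qed

text \<open>Only p - 1 of the p powers are spent on the uniform bound m; the remaining linear factor
  is what the semigroup property can act on.\<close>

lemma ennreal_powr_double_le:
  assumes a: "a \<le> ennreal m" and m: "0 \<le> m" and p: "1 < p"
  shows "ennreal_powr (2 * a) p \<le> ennreal (2 powr p * m powr (p - 1)) * a"
proof -
  obtain r where r: "a = ennreal r" "0 \<le> r" using a by (cases a) (auto simp: top_unique)
  have "r \<le> m" using a m by (simp add: r)
  have "(2 * r) powr p = 2 powr p * (r powr (p - 1) * r)"
    using r p by (cases "r = 0") (auto simp: powr_mult powr_diff)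
  also have "\<dots> \<le> 2 powr p * (m powr (p - 1) * r)"
    using r p \<open>r \<le> m\<close> by (intro mult_left_mono mult_right_mono powr_mono2) auto
  finally show ?thesis
    using r m by (simp add: ennreal_powr_def ennreal_mult_less_top ennreal_mult enn2real_mult mult.assoc flip: ennreal_mult ennreal_numeral)
qed

definition duhamel :: "real \<Rightarrow> real \<Rightarrow> 'a::euclidean_space measure \<Rightarrow> ('a \<Rightarrow> real \<Rightarrow> ennreal) \<Rightarrow> 'a \<Rightarrow> real \<Rightarrow> ennreal" where
  "duhamel \<theta> p \<mu> u x t = heat_evolution \<theta> \<mu> x t +
     (\<integral>\<^sup>+ s\<in>{0<..<t}. (\<integral>\<^sup>+ y. ennreal (heat \<theta> (x - y) (t - s)) * ennreal_powr (u y s) p \<partial>lborel) \<partial>lborel)"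

lemma duhamel_measurable:
  assumes \<mu>: "radon_measure \<mu>" and u: "(\<lambda>(x, t). u x t) \<in> borel_measurable (borel \<Otimes>\<^sub>M borel)"
  shows "(\<lambda>(x, t). duhamel \<theta> p \<mu> u x t) \<in> borel_measurable (borel \<Otimes>\<^sub>M borel)"
proof -
  note [measurable] = u heat_evolution_measurable[OF \<mu>, of \<theta>]
  have [measurable]: "(\<lambda>z. u (snd z) (snd (fst z))) \<in> borel_measurable (((borel \<Otimes>\<^sub>M borel) \<Otimes>\<^sub>M lborel) \<Otimes>\<^sub>M lborel)"
    using measurable_compose[OF _ u, of "\<lambda>z. (snd z, snd (fst z))"] by simp
  have [measurable]: "(\<lambda>z. \<integral>\<^sup>+ y. ennreal (heat \<theta> (fst (fst z) - y) (snd (fst z) - snd z)) * ennreal_powr (u y (snd z)) p \<partial>lborel)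
     \<in> borel_measurable ((borel \<Otimes>\<^sub>M borel) \<Otimes>\<^sub>M lborel)"
    by (intro lborel.borel_measurable_nn_integral) (simp add: split_beta')
  show ?thesis
    unfolding duhamel_def split_beta' indicator_def greaterThanLessThan_iff
    by measurable
qed

lemma nn_integral_powr_le:
  fixes q :: real
  assumes q: "q < 1" and t: "0 \<le> t"
  shows "(\<integral>\<^sup>+ s\<in>{0<..<t}. ennreal (s powr (- q)) \<partial>lborel) \<le> ennreal (t powr (1 - q) / (1 - q))"
proof -
  have "((\<lambda>s. s powr (- q)) has_integral (t powr (- q + 1) / (- q + 1))) {0..t}"
    by (rule has_integral_powr_from_0) (use q t in auto)
  then have I: "((\<lambda>s. if s \<in> {0..t} then s powr (- q) else 0) has_integral (t powr (1 - q) / (1 - q))) UNIV"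
    by (simp add: has_integral_restrict_UNIV add.commute del: atLeastAtMost_iff)
  have "(\<integral>\<^sup>+ s\<in>{0<..<t}. ennreal (s powr (- q)) \<partial>lborel) \<le> (\<integral>\<^sup>+ s. ennreal (if s \<in> {0..t} then s powr (- q) else 0) \<partial>lborel)"
    by (intro nn_integral_mono) (auto simp: indicator_def)
  also have "\<dots> = ennreal (t powr (1 - q) / (1 - q))"
    by (rule nn_integral_has_integral_lborel[OF _ _ I]) auto
  finally show ?thesis .
qed

text \<open>Comparison is asked only at earlier positive times, because the bound by the
  supersolution is available only before T.\<close>

lemma duhamel_mono:
  assumes "\<And>y s. 0 < s \<Longrightarrow> s < t \<Longrightarrow> u y s \<le> v y s" and "0 \<le> p"
  shows "duhamel \<theta> p \<mu> u x t \<le> duhamel \<theta> p \<mu> v x t"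
  unfolding duhamel_def using assms
  by (intro add_left_mono nn_integral_mono) (auto simp: indicator_def intro!: nn_integral_mono mult_left_mono ennreal_powr_mono)

text \<open>The hypothesis \<open>decay\<close> is the only quantitative information on the measure
  used by the iteration; \<open>small\<close> says that 2^p M^(p-1) times the integral of s^(-q)
  over (0,T) is at most 1.\<close>

context
  fixes \<theta> p T M q :: real and \<mu> :: "'a::euclidean_space measure"
  assumes \<theta>: "0 < \<theta>" and \<theta>2: "\<theta> \<le> 2" and p: "1 < p" and M: "0 \<le> M"
    and \<mu>: "radon_measure \<mu>"
    and decay: "\<And>x s. 0 < s \<Longrightarrow> s < T \<Longrightarrow> heat_evolution \<theta> \<mu> x s \<le> ennreal (M * s powr (- real DIM('a) / \<theta>))"
    and q_def: "q = (p - 1) * real DIM('a) / \<theta>" and q: "q < 1"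
    and small: "2 powr p * M powr (p - 1) * T powr (1 - q) / (1 - q) \<le> 1"
begin

lemma duhamel_double_le:
  assumes t: "0 < t" "t < T"
  shows "duhamel \<theta> p \<mu> (\<lambda>y s. 2 * heat_evolution \<theta> \<mu> y s) x t \<le> 2 * heat_evolution \<theta> \<mu> x t"
proof -
  let ?H = "heat_evolution \<theta> \<mu>"
  define K where "K = 2 powr p * M powr (p - 1)"
  have K: "K \<ge> 0" by (simp add: K_def)
  note [measurable] = heat_evolution_measurable[OF \<mu>, of \<theta>]
  have powr: "ennreal_powr (2 * ?H y s) p \<le> ennreal (K * s powr (- q)) * ?H y s" if "0 < s" "s < t" for y s
  proof -
    have "ennreal_powr (2 * ?H y s) p \<le> ennreal (2 powr p * (M * s powr (- real DIM('a) / \<theta>)) powr (p - 1)) * ?H y s"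
      using that t M p by (intro ennreal_powr_double_le decay) auto
    also have "(M * s powr (- real DIM('a) / \<theta>)) powr (p - 1) = M powr (p - 1) * s powr (- q)"
      using M that by (simp add: powr_mult powr_powr q_def mult.commute)
    finally show ?thesis by (simp add: K_def mult.assoc)
  qed
  have "(\<integral>\<^sup>+ s\<in>{0<..<t}. (\<integral>\<^sup>+ y. ennreal (heat \<theta> (x - y) (t - s)) * ennreal_powr (2 * ?H y s) p \<partial>lborel) \<partial>lborel)
     \<le> (\<integral>\<^sup>+ s. ennreal K * ?H x t * (ennreal (s powr (- q)) * indicator {0<..<t} s) \<partial>lborel)"
  proof (rule nn_integral_mono)
    fix s
    show "(\<integral>\<^sup>+ y. ennreal (heat \<theta> (x - y) (t - s)) * ennreal_powr (2 * ?H y s) p \<partial>lborel) * indicator {0<..<t} s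
       \<le> ennreal K * ?H x t * (ennreal (s powr (- q)) * indicator {0<..<t} s)"
    proof (cases "s \<in> {0<..<t}")
      case True
      then have s: "0 < s" "s < t" by auto
      have "(\<integral>\<^sup>+ y. ennreal (heat \<theta> (x - y) (t - s)) * ennreal_powr (2 * ?H y s) p \<partial>lborel)
        \<le> (\<integral>\<^sup>+ y. ennreal (K * s powr (- q)) * (ennreal (heat \<theta> (x - y) (t - s)) * ?H y s) \<partial>lborel)"
      proof (rule nn_integral_mono)
        fix y
        show "ennreal (heat \<theta> (x - y) (t - s)) * ennreal_powr (2 * ?H y s) p
          \<le> ennreal (K * s powr (- q)) * (ennreal (heat \<theta> (x - y) (t - s)) * ?H y s)"
          using mult_left_mono[OF powr[OF s, of y], of "ennreal (heat \<theta> (x - y) (t - s))"] by (simp add: mult.left_commute)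
      qed
      also have "\<dots> = ennreal (K * s powr (- q)) * ?H x t"
        by (subst nn_integral_cmult) (simp_all add: heat_evolution_semigroup[OF \<theta> \<theta>2 \<mu> s])
      also have "\<dots> = ennreal K * ?H x t * ennreal (s powr (- q))"
        using K by (simp add: ennreal_mult mult_ac)
      finally show ?thesis using True by simp
    qed simp
  qed
  also have "\<dots> = ennreal K * ?H x t * (\<integral>\<^sup>+ s\<in>{0<..<t}. ennreal (s powr (- q)) \<partial>lborel)"
    by (rule nn_integral_cmult) measurable
  also have "\<dots> \<le> ennreal K * ?H x t * ennreal (t powr (1 - q) / (1 - q))"
    by (intro mult_left_mono nn_integral_powr_le q) (use t in auto)
  also have "\<dots> = ennreal (K * (t powr (1 - q) / (1 - q))) * ?H x t"
    by (subst ennreal_mult[OF K]) (use q in \<open>simp_all add: mult_ac\<close>)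
  also have "\<dots> \<le> 1 * ?H x t"
  proof (intro mult_right_mono)
    have "K * (t powr (1 - q) / (1 - q)) \<le> K * (T powr (1 - q) / (1 - q))"
      using K q t by (intro mult_left_mono divide_right_mono powr_mono2) auto
    also have "\<dots> \<le> 1" using small by (simp add: K_def)
    finally show "ennreal (K * (t powr (1 - q) / (1 - q))) \<le> 1" by (simp add: ennreal_le_1)
  qed simp
  finally show ?thesis by (simp add: duhamel_def mult_2 add_left_mono)
qed

text \<open>Starting from 0 makes the iterates increasing at once, so monotone convergence handles
  both integrals. The bound by twice the heat evolution is finite everywhere, so the equation holds
  at every x.\<close>

lemma is_solution_of_decay: "\<exists>u. is_solution \<theta> p \<mu> (ereal T) u"
proof -
  let ?H = "heat_evolution \<theta> \<mu>"
  define w where "w n = (duhamel \<theta> p \<mu> ^^ n) (\<lambda>_ _. 0)" for n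
  have w0: "w 0 = (\<lambda>_ _. 0)" and wS: "w (Suc n) = duhamel \<theta> p \<mu> (w n)" for n by (simp_all add: w_def)
  have p0: "0 \<le> p" using p by simp
  have wmeas [measurable]: "(\<lambda>(x, t). w n x t) \<in> borel_measurable (borel \<Otimes>\<^sub>M borel)" for n
    by (induction n) (simp_all add: w0 wS duhamel_measurable[OF \<mu>])
  have w_step: "w n x t \<le> w (Suc n) x t" for n x t
  proof (induction n arbitrary: x t)
    case (Suc n)
    have "duhamel \<theta> p \<mu> (w n) x t \<le> duhamel \<theta> p \<mu> (w (Suc n)) x t" by (rule duhamel_mono[OF Suc p0])
    then show ?case by (simp only: wS)
  qed (simp add: w0)
  then have inc: "incseq (\<lambda>n. w n x t)" for x t by (rule incseq_SucI)
  have w_le: "w n x t \<le> 2 * ?H x t" if "0 < t" "t < T" for n x t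
    using that
  proof (induction n arbitrary: x t)
    case (Suc n)
    have "w (Suc n) x t \<le> duhamel \<theta> p \<mu> (\<lambda>y s. 2 * ?H y s) x t"
      unfolding wS using Suc by (intro duhamel_mono p0) auto
    also have "\<dots> \<le> 2 * ?H x t" by (rule duhamel_double_le[OF Suc.prems])
    finally show ?case .
  qed (simp add: w0)
  define u where "u x t = (SUP n. w n x t)" for x t
  have lim: "(\<lambda>n. w n x t) \<longlonglongrightarrow> u x t" for x t
    unfolding u_def by (rule LIMSEQ_SUP[OF inc])
  have umeas: "(\<lambda>(x, t). u x t) \<in> borel_measurable (borel \<Otimes>\<^sub>M borel)"
    unfolding u_def split_beta' by (intro borel_measurable_SUP) (use wmeas in \<open>auto simp: split_beta'\<close>)
  have u_fin: "u x t < \<infinity>" if t: "0 < t" "t < T" for x t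
  proof -
    have "u x t \<le> 2 * ?H x t" unfolding u_def by (intro SUP_least w_le t)
    also have "\<dots> \<le> 2 * ennreal (M * t powr (- real DIM('a) / \<theta>))" by (intro mult_left_mono decay t) simp
    also have "\<dots> < \<infinity>" by (simp add: ennreal_mult_less_top)
    finally show ?thesis .
  qed
  \<comment> \<open>Both sides are limits of the shifted iterates
    \<open>w (Suc n) x t\<close>.\<close>
  have u_eq: "u x t = duhamel \<theta> p \<mu> u x t" if t: "0 < t" "t < T" for x t
  proof (rule LIMSEQ_unique)
    show "(\<lambda>n. w (Suc n) x t) \<longlonglongrightarrow> u x t" by (rule LIMSEQ_Suc[OF lim])
    have sec: "(\<lambda>y. w n y s) \<in> borel_measurable borel" for n s
      using measurable_compose[OF _ wmeas[of n], of "\<lambda>y. (y, s)" borel] by simp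
    have inner_meas: "(\<lambda>s. (\<integral>\<^sup>+ y. ennreal (heat \<theta> (x - y) (t - s)) * ennreal_powr (w n y s) p \<partial>lborel)) \<in> borel_measurable lborel" for n
    proof (intro lborel.borel_measurable_nn_integral)
      have "(\<lambda>z. w n (snd z) (fst z)) \<in> borel_measurable (borel \<Otimes>\<^sub>M borel)"
        using measurable_compose[OF _ wmeas[of n], of "\<lambda>z. (snd z, fst z)"] by simp
      then show "(\<lambda>(s, y). ennreal (heat \<theta> (x - y) (t - s)) * ennreal_powr (w n y s) p) \<in> borel_measurable (lborel \<Otimes>\<^sub>M lborel)"
        by (simp add: split_beta')
    qed
    have inc_int: "ennreal (heat \<theta> (x - y) (t - s)) * ennreal_powr (w m y s) p \<le> ennreal (heat \<theta> (x - y) (t - s)) * ennreal_powr (w n y s) p"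
      if "m \<le> n" for m n y s
      using incseqD[OF inc that] p0 by (intro mult_left_mono ennreal_powr_mono) auto
    have inner: "(\<lambda>n. \<integral>\<^sup>+ y. ennreal (heat \<theta> (x - y) (t - s)) * ennreal_powr (w n y s) p \<partial>lborel)
       \<longlonglongrightarrow> (\<integral>\<^sup>+ y. ennreal (heat \<theta> (x - y) (t - s)) * ennreal_powr (u y s) p \<partial>lborel)" if s: "0 < s" "s < t" for s
    proof (rule nn_integral_LIMSEQ)
      show "incseq (\<lambda>n y. ennreal (heat \<theta> (x - y) (t - s)) * ennreal_powr (w n y s) p)"
        by (auto simp: incseq_def le_fun_def intro: inc_int)
      \<comment> \<open>Finiteness of u at times before T reduces the limit of powers to continuity
        of the real power.\<close>
      show "(\<lambda>n. ennreal (heat \<theta> (x - y) (t - s)) * ennreal_powr (w n y s) p)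
         \<longlonglongrightarrow> ennreal (heat \<theta> (x - y) (t - s)) * ennreal_powr (u y s) p" for y
        using s t p by (intro ennreal_tendsto_cmult ennreal_powr_tendsto lim u_fin) auto
    qed (use sec in measurable)
    have "(\<lambda>n. \<integral>\<^sup>+ s\<in>{0<..<t}. (\<integral>\<^sup>+ y. ennreal (heat \<theta> (x - y) (t - s)) * ennreal_powr (w n y s) p \<partial>lborel) \<partial>lborel)
       \<longlonglongrightarrow> (\<integral>\<^sup>+ s\<in>{0<..<t}. (\<integral>\<^sup>+ y. ennreal (heat \<theta> (x - y) (t - s)) * ennreal_powr (u y s) p \<partial>lborel) \<partial>lborel)"
    proof (rule nn_integral_LIMSEQ)
      show "incseq (\<lambda>n s. (\<integral>\<^sup>+ y. ennreal (heat \<theta> (x - y) (t - s)) * ennreal_powr (w n y s) p \<partial>lborel) * indicator {0<..<t} s)"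
        by (auto simp: incseq_def le_fun_def intro!: mult_right_mono nn_integral_mono inc_int)
      show "(\<lambda>n. (\<integral>\<^sup>+ y. ennreal (heat \<theta> (x - y) (t - s)) * ennreal_powr (w n y s) p \<partial>lborel) * indicator {0<..<t} s)
        \<longlonglongrightarrow> (\<integral>\<^sup>+ y. ennreal (heat \<theta> (x - y) (t - s)) * ennreal_powr (u y s) p \<partial>lborel) * indicator {0<..<t} s" for s
        using inner[of s] by (cases "s \<in> {0<..<t}") auto
    qed (use inner_meas in measurable)
    then show "(\<lambda>n. w (Suc n) x t) \<longlonglongrightarrow> duhamel \<theta> p \<mu> u x t"
      unfolding wS duhamel_def by (intro tendsto_add tendsto_const)
  qed
  have "is_solution \<theta> p \<mu> (ereal T) u"
    unfolding is_solution_def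
  proof (intro conjI allI impI AE_I2)
    have "(\<lambda>(x, t). u x t) \<in> borel_measurable lborel" using umeas by (simp add: borel_prod)
    then show "(\<lambda>(x, t). u x t) \<in> borel_measurable (lebesgue_on (UNIV \<times> {t. 0 < t \<and> ereal t < ereal T}))"
      by (intro measurable_restrict_space1 measurable_completion)
    fix t x assume "0 < t \<and> ereal t < ereal T"
    then have t: "0 < t" "t < T" by auto
    show "u x t < \<infinity>" by (rule u_fin[OF t])
    \<comment> \<open>Inside the indicator t - s is positive, so the two kernels agree
      there.\<close>
    have "(\<integral>\<^sup>+ s\<in>{0<..<t}. (\<integral>\<^sup>+ y. ennreal (frac_heat_kernel \<theta> (x - y) (t - s)) * ennreal_powr (u y s) p \<partial>lborel) \<partial>lborel)
       = (\<integral>\<^sup>+ s\<in>{0<..<t}. (\<integral>\<^sup>+ y. ennreal (heat \<theta> (x - y) (t - s)) * ennreal_powr (u y s) p \<partial>lborel) \<partial>lborel)"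
      by (intro nn_integral_cong) (auto simp: indicator_def frac_heat_kernel_eq[OF \<theta> _ \<theta>2])
    then show "u x t = (\<integral>\<^sup>+ y. ennreal (frac_heat_kernel \<theta> (x - y) t) \<partial>\<mu>) +
       (\<integral>\<^sup>+ s\<in>{0<..<t}. (\<integral>\<^sup>+ y. ennreal (frac_heat_kernel \<theta> (x - y) (t - s)) * ennreal_powr (u y s) p \<partial>lborel) \<partial>lborel)"
      by (simp add: u_eq[OF t, of x] duhamel_def heat_evolution_def frac_heat_kernel_eq[OF \<theta> t(1) \<theta>2] flip: u_eq)
  qed
  then show ?thesis by blast
qed

end

theorem theorem1p3:
  fixes \<theta> p :: real
  assumes "0 < \<theta>" and "\<theta> \<le> 2"
    and "1 < p" and "p < 1 + \<theta> / real CARD('n::finite)"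
  shows "\<exists>\<gamma>\<^sub>2 > 0. \<forall>(\<mu> :: (real ^ 'n) measure) T.
           radon_measure \<mu> \<longrightarrow> 0 < T \<longrightarrow>
           (SUP x. emeasure \<mu> (ball x (T powr (1 / \<theta>))))
             \<le> ennreal (\<gamma>\<^sub>2 * T powr (real CARD('n) / \<theta> - 1 / (p - 1))) \<longrightarrow>
           (\<exists>u. is_solution \<theta> p \<mu> (ereal T) u)"
proof -
  define C where "C = heat_bound \<theta> TYPE(real ^ 'n)"
  define q where "q = (p - 1) * real CARD('n) / \<theta>"
  \<comment> \<open>The solution of 2^p \<delta>^(p-1)/(1-q) = 1, so that \<open>small\<close> will
    hold with equality.\<close>
  define \<delta> where "\<delta> = ((1 - q) / 2 powr p) powr (1 / (p - 1))"
  have C: "C > 0" unfolding C_def by (rule heat_bound_pos[OF assms(1,2)])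
  have q: "q < 1" using assms by (simp add: q_def field_simps)
  have \<delta>: "\<delta> > 0" using q by (simp add: \<delta>_def)
  show ?thesis
  proof (intro exI[of _ "\<delta> / C"] conjI allI impI)
    show "\<delta> / C > 0" using \<delta> C by simp
    fix \<mu> :: "(real ^ 'n) measure" and T
    assume \<mu>: "radon_measure \<mu>" and T: "0 < T"
      and sup: "(SUP x. emeasure \<mu> (ball x (T powr (1 / \<theta>)))) \<le> ennreal (\<delta> / C * T powr (real CARD('n) / \<theta> - 1 / (p - 1)))"
    define M where "M = \<delta> * T powr (real CARD('n) / \<theta> - 1 / (p - 1))"
    have M: "0 \<le> M" using \<delta> by (simp add: M_def)
    show "\<exists>u. is_solution \<theta> p \<mu> (ereal T) u"
    proof (rule is_solution_of_decay[OF assms(1-3) M \<mu>, of T q])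
      show "heat_evolution \<theta> \<mu> x s \<le> ennreal (M * s powr (- real DIM(real ^ 'n) / \<theta>))" if s: "0 < s" "s < T" for x s
      proof -
        have "heat_evolution \<theta> \<mu> x s \<le> ennreal (C * s powr (- real DIM(real ^ 'n) / \<theta>)) * (SUP x. emeasure \<mu> (ball x (s powr (1 / \<theta>))))"
          unfolding C_def by (rule heat_evolution_le[OF assms(1,2) \<mu> s(1)])
        \<comment> \<open>For s < T the smaller balls lie in the balls of radius T^(1/\<theta>), so
          one hypothesis at the scale T controls all earlier times.\<close>
        also have "(SUP x. emeasure \<mu> (ball x (s powr (1 / \<theta>)))) \<le> (SUP x. emeasure \<mu> (ball x (T powr (1 / \<theta>))))"
          using s assms(1) by (intro SUP_mono' emeasure_mono subset_ball powr_mono2) (auto simp: radon_measure_sets[OF \<mu>])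
        also note sup
        also have "ennreal (C * s powr (- real DIM(real ^ 'n) / \<theta>)) * ennreal (\<delta> / C * T powr (real CARD('n) / \<theta> - 1 / (p - 1)))
          = ennreal (M * s powr (- real DIM(real ^ 'n) / \<theta>))"
          using C \<delta> by (simp add: M_def mult_ac flip: ennreal_mult)
        finally show ?thesis by (simp add: mult_left_mono)
      qed
      show "q = (p - 1) * real DIM(real ^ 'n) / \<theta>" by (simp add: q_def)
      \<comment> \<open>The exponent of T in M, multiplied by p - 1, is q - 1: exactly what cancels
        the T^(1-q) of the time integral.\<close>
      have "M powr (p - 1) = (1 - q) / 2 powr p * T powr (q - 1)"
      proof -
        have "(real CARD('n) / \<theta> - 1 / (p - 1)) * (p - 1) = q - 1"
          using assms by (simp add: q_def left_diff_distrib) (simp add: algebra_simps)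
        moreover have "\<delta> powr (p - 1) = (1 - q) / 2 powr p"
          using assms q by (simp add: \<delta>_def powr_powr)
        ultimately show ?thesis using \<delta> by (simp add: M_def powr_mult powr_powr)
      qed
      moreover have "T powr (q - 1) * T powr (1 - q) = 1"
        using T by (simp flip: powr_add)
      ultimately show "2 powr p * M powr (p - 1) * T powr (1 - q) / (1 - q) \<le> 1"
        using q by (simp add: mult.assoc)
    qed (rule q)
  qed
qed

end
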